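(* Let $0<\lambda<1/e$, $E(z)=\lambda e^z$, and let $s>1$. Let $h(t)=t/(\log(1/t))^s$ (defined for small $t>0$). Then $\mathcal H^h(\mathcal J(E)\setminus\mathcal C)=0$.
   Context: For $0<\lambda<1/e$ the function $E(z)=\lambda e^z$ has two real fixed points $\alpha<1<\beta$, with $\alpha$ attracting and $\beta$ repelling. The Fatou set $\mathcal F(E)$ is the set of points where the iterates $E^n$ form a normal family, and the Julia set is $\mathcal J(E)=\mathbb C\setminus\mathcal F(E)$. By a theorem of Devaney and Krych, $\mathcal F(E)$ is the attracting basin of $\alpha$ and $\mathcal J(E)$ is a union of uncountably many pairwise disjoint curves ("hairs"), each connecting a point of $\mathbb C$ (the endpoint of the hair) with $\infty$; each hair is the set of points of $\mathcal J(E)$ sharing a given itinerary, where the itinerary of $z$ is the sequence $(s_j)$ with $(2s_j-1)\pi\le \operatorname{Im}E^j(z)<(2s_j+1)\pi$. $\mathcal C$ denotes the set of endpoints of these hairs. For a gauge function $h$ (an increasing continuous $h:(0,t_0)\to(0,\infty)$ with $h(t)\to0$ as $t\to0$) and $A\subset\mathbb R^m$, $\mathcal H^h(A)=\lim_{\delta\to0}\inf\{\sum_k h(\operatorname{diam}A_k)\}$, the infimum over all countable covers $(A_k)$ of $A$ with $\operatorname{diam}A_k<\delta$. *)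

theory Defs
  imports "HOL-Analysis.Analysis"
begin

definition expmap :: "real \<Rightarrow> complex \<Rightarrow> complex" where
  "expmap lam z = complex_of_real lam * exp z"

text \<open>Normality of the family of iterates of f at the point z: there is an open
  neighbourhood U of z such that every subsequence of (f^n) has a further
  subsequence converging locally uniformly on U, either to a (finite) limit
  function or to infinity (i.e. convergence in the spherical metric).\<close>
definition normal_at :: "(complex \<Rightarrow> complex) \<Rightarrow> complex \<Rightarrow> bool" where
  "normal_at f z \<longleftrightarrow>
     (\<exists>U. open U \<and> z \<in> U \<and>
        (\<forall>r::nat\<Rightarrow>nat. strict_mono r \<longrightarrow>
           (\<exists>q::nat\<Rightarrow>nat. strict_mono q \<and>
              ((\<exists>g. \<forall>K. compact K \<and> K \<subseteq> U \<longrightarrow>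
                   uniform_limit K (\<lambda>n. (f ^^ (r (q n)))) g sequentially)
               \<or> (\<forall>K. compact K \<and> K \<subseteq> U \<longrightarrow>
                   (\<forall>M. eventually (\<lambda>n. \<forall>x\<in>K. norm ((f ^^ (r (q n))) x) \<ge> M) sequentially))))))"

definition fatou_set :: "(complex \<Rightarrow> complex) \<Rightarrow> complex set" where
  "fatou_set f = {z. normal_at f z}"

definition julia_set :: "(complex \<Rightarrow> complex) \<Rightarrow> complex set" where
  "julia_set f = UNIV - fatou_set f"

text \<open>Itinerary: s_j with (2 s_j - 1) pi \<le> Im f^j(z) < (2 s_j + 1) pi.\<close>
definition itinerary :: "(complex \<Rightarrow> complex) \<Rightarrow> complex \<Rightarrow> nat \<Rightarrow> int" where
  "itinerary f z j = floor ((Im ((f ^^ j) z) + pi) / (2 * pi))"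

definition hair :: "(complex \<Rightarrow> complex) \<Rightarrow> (nat \<Rightarrow> int) \<Rightarrow> complex set" where
  "hair f s = {z \<in> julia_set f. itinerary f z = s}"

definition endpoints :: "(complex \<Rightarrow> complex) \<Rightarrow> complex set" where
  "endpoints f = {\<gamma> 0 | \<gamma> s. continuous_on {0..} \<gamma> \<and> inj_on \<gamma> {0..} \<and>
                     \<gamma> ` {0..} = hair f s \<and>
                     filterlim (\<lambda>t. norm (\<gamma> (t::real))) at_top at_top}"

definition hausdorff_gauge :: "(real \<Rightarrow> real) \<Rightarrow> complex set \<Rightarrow> ennreal" where
  "hausdorff_gauge h A =
     (SUP \<delta>\<in>{0<..}. INF C\<in>{C :: nat \<Rightarrow> complex set. A \<subseteq> (\<Union>k. C k) \<and>
                         (\<forall>k. bounded (C k) \<and> diameter (C k) < \<delta>)}.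
                  (\<Sum>k. ennreal (h (diameter (C k)))))"

end

theory Submission
  imports Defs "HOL-Complex_Analysis.Complex_Analysis" "HOL-Real_Asymp.Real_Asymp"
begin

text \<open>
  Put \<open>B = - ln \<lambda> > 1\<close>, so that \<open>E z = exp (z - B)\<close>. The Julia set is the set of points whose orbit
  stays in the half-plane \<open>Re z \<ge> B\<close>: every other orbit enters the unit disc, on which \<open>E\<close> contracts,
  while on trapped orbits the derivatives of the iterates grow like \<open>B^n\<close>.

  Two points of a hair have imaginary parts at distance less than \<open>pi\<close> along their orbits, while
  their orbits move apart exponentially; hence their real parts separate, which orders the hair
  linearly. From a minimal point \<open>z\<close> one obtains a parametrisation of the whole hair by pulling back
  horizontal translates of \<open>E^n z\<close>, so \<open>z\<close> is an endpoint.

  If \<open>z\<close> is not minimal, comparison with a smaller point shows that, for \<open>z_n = E^n z\<close>, eventually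
  \<open>|Im z_n| \<le> Re z_n\<close> and \<open>|Im z_(n+1)| \<le> exp (Re z_n / 2)\<close>. A unit box at real part \<open>a\<close> is mapped
  by \<open>E\<close> to size about \<open>R = exp (a - B)\<close>, and its points of this kind land in a strip of height
  about \<open>sqrt R\<close>. Covering that strip by squares of the size of its height bounds the gauge sum by a
  multiple of \<open>a^(-s)\<close>. Covering the image instead by \<open>O(R^2)\<close> unit boxes, each pulled back
  with contraction \<open>O(1/R)\<close>, improves a bound \<open>c a^(-s)\<close> to \<open>O(c R^(1-s))\<close>, which is at most
  \<open>c a^(-s) / 2\<close> for large \<open>a\<close> because \<open>s > 1\<close>. Iteration gives measure zero.
\<close>

section \<open>Gauge contents\<close>

definition gauge_content :: "(real \<Rightarrow> real) \<Rightarrow> real \<Rightarrow> 'a::metric_space set \<Rightarrow> ennreal" where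
  "gauge_content h \<delta> A =
     (INF C\<in>{C :: nat \<Rightarrow> 'a set. A \<subseteq> (\<Union>k. C k) \<and> (\<forall>k. bounded (C k) \<and> diameter (C k) < \<delta>)}.
        (\<Sum>k. ennreal (h (diameter (C k)))))"

definition starshaped_gauge :: "real \<Rightarrow> (real \<Rightarrow> real) \<Rightarrow> bool" where
  "starshaped_gauge r h \<longleftrightarrow>
     h 0 = 0 \<and> (\<forall>t\<in>{0<..<r}. 0 \<le> h t) \<and> mono_on {0<..<r} (\<lambda>t. h t / t)"

lemma starshaped_gauge_0: "starshaped_gauge r h \<Longrightarrow> h 0 = 0"
  by (simp add: starshaped_gauge_def)

lemma starshaped_gauge_nonneg:
  assumes "starshaped_gauge r h" "0 \<le> t" "t < r"
  shows "0 \<le> h t"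
  using assms by (cases "t = 0") (auto simp: starshaped_gauge_def)

lemma starshaped_gauge_scale_le:
  assumes h: "starshaped_gauge r h" and u: "0 \<le> u" "u \<le> c * t" and c: "0 \<le> c" "c \<le> 1"
    and t: "0 \<le> t" "t < r"
  shows "h u \<le> c * h t"
proof (cases "u = 0")
  case True
  then show ?thesis
    using starshaped_gauge_0[OF h] starshaped_gauge_nonneg[OF h t] c by simp
next
  case False
  have "c * t \<le> t"
    using c t by (simp add: mult_left_le_one_le)
  then have pos: "0 < u" "u \<le> t"
    using False u by auto
  then have "h u / u \<le> h t / t"
    using h t mono_onD[of "{0<..<r}" "\<lambda>t. h t / t" u t] by (auto simp: starshaped_gauge_def)
  then have "h u \<le> u * (h t / t)"
    using pos by (simp add: field_simps)
  also have "\<dots> \<le> (c * t) * (h t / t)"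
    using u pos starshaped_gauge_nonneg[OF h t] by (intro mult_right_mono) auto
  finally show ?thesis
    using pos by simp
qed

lemma starshaped_gauge_mono:
  assumes "starshaped_gauge r h" "0 \<le> u" "u \<le> t" "t < r"
  shows "h u \<le> h t"
  using starshaped_gauge_scale_le[of r h u 1 t] assms by simp

lemma gauge_content_le:
  assumes "A \<subseteq> (\<Union>k. C k)" "\<And>k. bounded (C k)" "\<And>k. diameter (C k) < \<delta>"
  shows "gauge_content h \<delta> A \<le> (\<Sum>k. ennreal (h (diameter (C k))))"
  unfolding gauge_content_def by (rule INF_lower) (use assms in auto)

lemma gauge_content_mono:
  assumes "A \<subseteq> A'" "\<delta>' \<le> \<delta>"
  shows "gauge_content h \<delta> A \<le> gauge_content h \<delta>' A'"
  unfolding gauge_content_def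
  by (rule INF_superset_mono) (use assms in \<open>auto 0 3 intro: less_le_trans\<close>)

lemma gauge_content_approx:
  assumes "gauge_content h \<delta> A < top" "0 < e"
  obtains C where "A \<subseteq> (\<Union>k. C k)" "\<And>k. bounded (C k)" "\<And>k. diameter (C k) < \<delta>"
    "(\<Sum>k. ennreal (h (diameter (C k)))) \<le> gauge_content h \<delta> A + ennreal e"
proof -
  have "gauge_content h \<delta> A < gauge_content h \<delta> A + ennreal e"
    using assms by (auto simp: ennreal_add_left_cancel_less intro!: ennreal_less_top)
  then show thesis
    by (subst (asm) (1) gauge_content_def) (auto simp: INF_less_iff intro: that less_imp_le)
qed

lemma gauge_content_empty [simp]:
  assumes "h 0 = 0" "0 < \<delta>"
  shows "gauge_content h \<delta> {} = 0"
  using gauge_content_le[of "{}" "\<lambda>_. {}" \<delta> h] assms by simp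

lemma gauge_content_le_diameter:
  assumes h: "starshaped_gauge r h" and A: "bounded A" "diameter A \<le> t" and t: "t < \<delta>" "\<delta> \<le> r"
  shows "gauge_content h \<delta> A \<le> ennreal (h t)"
proof -
  define C where "C k = (if k = (0::nat) then A else {})" for k
  have diam: "0 \<le> diameter A"
    using A(1) by (rule diameter_ge_0)
  have "gauge_content h \<delta> A \<le> (\<Sum>k. ennreal (h (diameter (C k))))"
    by (rule gauge_content_le) (use A t diam in \<open>auto simp: C_def split: if_splits\<close>)
  also have "\<dots> = (\<Sum>k\<in>{0}. ennreal (h (diameter (C k))))"
    by (rule suminf_finite) (auto simp: C_def starshaped_gauge_0[OF h])
  also have "\<dots> = ennreal (h (diameter A))"
    by (simp add: C_def)
  also have "\<dots> \<le> ennreal (h t)"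
    using A t diam by (intro ennreal_leI starshaped_gauge_mono[OF h]) auto
  finally show ?thesis .
qed

lemma gauge_content_UN:
  fixes S :: "nat \<Rightarrow> 'a::metric_space set"
  shows "gauge_content h \<delta> (\<Union>i. S i) \<le> (\<Sum>i. gauge_content h \<delta> (S i))"
proof (rule ennreal_le_epsilon)
  fix e :: real assume sum_finite: "(\<Sum>i. gauge_content h \<delta> (S i)) < top" and "0 < e"
  define \<epsilon> where "\<epsilon> i = e * (1/2) ^ Suc i" for i
  have content_finite: "gauge_content h \<delta> (S i) < top" for i
    using sum_le_suminf[of "\<lambda>i. gauge_content h \<delta> (S i)" "{i}"] sum_finite
    by (auto intro: le_less_trans)
  have "\<exists>C. S i \<subseteq> (\<Union>k. C k) \<and> (\<forall>k. bounded (C k) \<and> diameter (C k) < \<delta>) \<and>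
      (\<Sum>k. ennreal (h (diameter (C k)))) \<le> gauge_content h \<delta> (S i) + ennreal (\<epsilon> i)" for i
    by (rule gauge_content_approx[OF content_finite, of "\<epsilon> i" i]) (use \<open>0 < e\<close> in \<open>auto simp: \<epsilon>_def\<close>)
  then obtain C where C: "\<And>i. S i \<subseteq> (\<Union>k. C i k)" "\<And>i k. bounded (C i k)" "\<And>i k. diameter (C i k) < \<delta>"
    and C_sum: "\<And>i. (\<Sum>k. ennreal (h (diameter (C i k)))) \<le> gauge_content h \<delta> (S i) + ennreal (\<epsilon> i)"
    by metis
  define D where "D = (\<lambda>(i, k). C i k) \<circ> prod_decode"
  have "(\<Union>i. S i) \<subseteq> (\<Union>n. D n)"
  proof (intro UN_least subsetI)
    fix i x assume "x \<in> S i"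
    then obtain k where "x \<in> C i k"
      using C(1) by blast
    then have "x \<in> D (prod_encode (i, k))"
      by (simp add: D_def)
    then show "x \<in> (\<Union>n. D n)"
      by blast
  qed
  then have "gauge_content h \<delta> (\<Union>i. S i) \<le> (\<Sum>n. ennreal (h (diameter (D n))))"
    by (rule gauge_content_le) (auto simp: D_def C split: prod.split)
  also have "\<dots> = (\<Sum>n. (\<lambda>(i, k). ennreal (h (diameter (C i k)))) (prod_decode n))"
    by (simp add: D_def case_prod_beta)
  also have "\<dots> = (\<Sum>i. \<Sum>k. ennreal (h (diameter (C i k))))"
    by (rule suminf_ennreal_2dimen) simp
  also have "\<dots> \<le> (\<Sum>i. gauge_content h \<delta> (S i) + ennreal (\<epsilon> i))"
    by (rule suminf_le[OF C_sum]) auto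
  also have "\<dots> = (\<Sum>i. gauge_content h \<delta> (S i)) + (\<Sum>i. ennreal (\<epsilon> i))"
    by (rule suminf_add[symmetric]) auto
  also have "(\<Sum>i. ennreal (\<epsilon> i)) = ennreal e"
    using sums_mult[OF power_half_series, of e] \<open>0 < e\<close>
    by (intro suminf_ennreal_eq) (auto simp: \<epsilon>_def)
  finally show "gauge_content h \<delta> (\<Union>i. S i) \<le> (\<Sum>i. gauge_content h \<delta> (S i)) + ennreal e" .
qed

lemma gauge_content_finite_cover:
  assumes h: "h 0 = 0" and "0 < \<delta>" and I: "finite I" and A: "A \<subseteq> (\<Union>i\<in>I. S i)"
    and S: "\<And>i. i \<in> I \<Longrightarrow> gauge_content h \<delta> (S i) \<le> e"
  shows "gauge_content h \<delta> A \<le> of_nat (card I) * e"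
proof -
  obtain f where "bij_betw f {0..<card I} I"
    using ex_bij_betw_nat_finite[OF I] by blast
  then have f: "f ` {..<card I} = I"
    by (simp add: bij_betw_def atLeast0LessThan)
  define T where "T n = (if n < card I then S (f n) else {})" for n
  have "(\<Union>i\<in>I. S i) \<subseteq> (\<Union>n. T n)"
  proof (rule UN_least)
    fix i assume "i \<in> I"
    then obtain n where "n < card I" "i = f n"
      using f by blast
    then have "S i = T n"
      by (simp add: T_def)
    then show "S i \<subseteq> (\<Union>n. T n)"
      by blast
  qed
  then have "gauge_content h \<delta> A \<le> gauge_content h \<delta> (\<Union>n. T n)"
    using A by (intro gauge_content_mono) auto
  also have "\<dots> \<le> (\<Sum>n. gauge_content h \<delta> (T n))"
    by (rule gauge_content_UN)
  also have "\<dots> = (\<Sum>n<card I. gauge_content h \<delta> (T n))"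
    by (rule suminf_finite) (auto simp: T_def h \<open>0 < \<delta>\<close>)
  also have "\<dots> \<le> of_nat (card {..<card I}) * e"
  proof (rule sum_bounded_above)
    fix n assume "n \<in> {..<card I}"
    then show "gauge_content h \<delta> (T n) \<le> e"
      using S[of "f n"] f by (auto simp: T_def)
  qed
  finally show ?thesis
    by simp
qed

lemma
  fixes g :: "'a::metric_space \<Rightarrow> 'b::metric_space"
  assumes g: "c-lipschitz_on S g" and S: "bounded S"
  shows bounded_lipschitz_image: "bounded (g ` S)"
    and diameter_lipschitz_image_le: "diameter (g ` S) \<le> c * diameter S"
proof -
  have dist: "dist (g x) (g y) \<le> c * diameter S" if "x \<in> S" "y \<in> S" for x y
    using lipschitz_onD[OF g that] diameter_bounded_bound[OF S that] lipschitz_on_nonneg[OF g]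
    by (meson mult_left_mono order_trans)
  then show "bounded (g ` S)"
    unfolding bounded_two_points by blast
  show "diameter (g ` S) \<le> c * diameter S"
  proof (cases "S = {}")
    case False
    then show ?thesis
      using dist by (auto simp: diameter_def[of "g ` S"] intro!: cSUP_least)
  qed simp
qed

lemma ennreal_le_mult_INF:
  fixes f :: "'a \<Rightarrow> ennreal"
  assumes "0 < c" "\<And>i. i \<in> I \<Longrightarrow> x \<le> ennreal c * f i"
  shows "x \<le> ennreal c * (INF i\<in>I. f i)"
proof -
  have "x / ennreal c \<le> (INF i\<in>I. f i)"
    using assms by (intro INF_greatest divide_le_posI_ennreal) auto
  then have "ennreal c * (x / ennreal c) \<le> ennreal c * (INF i\<in>I. f i)"
    by (rule mult_left_mono) simp
  moreover have "ennreal c * (x / ennreal c) = x"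
    using assms(1) by (simp add: ennreal_times_divide ennreal_mult_divide_eq mult.commute[of _ x])
  ultimately show ?thesis
    by simp
qed

lemma gauge_content_lipschitz_image:
  fixes g :: "'a::metric_space \<Rightarrow> 'b::metric_space"
  assumes g: "c-lipschitz_on S g" and h: "starshaped_gauge r h" and c: "0 < c" "c \<le> 1"
    and "\<delta> \<le> r"
  shows "gauge_content h (c * \<delta>) (g ` S) \<le> ennreal c * gauge_content h \<delta> S"
  unfolding gauge_content_def[of h \<delta> S]
proof (rule ennreal_le_mult_INF[OF c(1)])
  fix C :: "nat \<Rightarrow> 'a set"
  assume "C \<in> {C. S \<subseteq> (\<Union>k. C k) \<and> (\<forall>k. bounded (C k) \<and> diameter (C k) < \<delta>)}"
  then have C: "S \<subseteq> (\<Union>k. C k)" "\<And>k. bounded (C k)" "\<And>k. diameter (C k) < \<delta>"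
    by auto
  define D where "D k = g ` (C k \<inter> S)" for k
  have lip: "c-lipschitz_on (C k \<inter> S) g" for k
    using g by (rule lipschitz_on_subset) simp
  have bounded_D: "bounded (D k)" for k
    unfolding D_def using C(2) by (intro bounded_lipschitz_image[OF lip] bounded_Int) simp
  have diam_D: "diameter (D k) \<le> c * diameter (C k)" for k
  proof -
    have "diameter (D k) \<le> c * diameter (C k \<inter> S)"
      unfolding D_def using C(2) by (intro diameter_lipschitz_image_le[OF lip] bounded_Int) simp
    also have "\<dots> \<le> c * diameter (C k)"
      using c C(2) by (intro mult_left_mono diameter_subset) auto
    finally show ?thesis .
  qed
  have "diameter (D k) < c * \<delta>" for k
    using diam_D[of k] C(3)[of k] c by (simp add: le_less_trans)
  then have "gauge_content h (c * \<delta>) (g ` S) \<le> (\<Sum>k. ennreal (h (diameter (D k))))"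
    using C(1) bounded_D by (intro gauge_content_le) (fastforce simp: D_def)+
  also have "\<dots> \<le> (\<Sum>k. ennreal c * ennreal (h (diameter (C k))))"
  proof (intro suminf_le)
    fix k
    have "h (diameter (D k)) \<le> c * h (diameter (C k))"
      using starshaped_gauge_scale_le[OF h diameter_ge_0[OF bounded_D] diam_D] C c \<open>\<delta> \<le> r\<close>
      by (meson diameter_ge_0 less_imp_le less_le_trans)
    then show "ennreal (h (diameter (D k))) \<le> ennreal c * ennreal (h (diameter (C k)))"
      using c by (subst ennreal_mult'[symmetric]) (auto intro: ennreal_leI)
  qed auto
  also have "\<dots> = ennreal c * (\<Sum>k. ennreal (h (diameter (C k))))"
    by (rule ennreal_suminf_cmult)
  finally show "gauge_content h (c * \<delta>) (g ` S) \<le> ennreal c * (\<Sum>k. ennreal (h (diameter (C k))))" .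
qed

lemma
  fixes V :: "complex set"
  assumes V: "\<And>w. w \<in> V \<Longrightarrow> x \<le> Re w \<and> Re w \<le> x + H \<and> \<bar>Im w\<bar> \<le> H" and "0 \<le> H"
  shows bounded_rectangle: "bounded V" and diameter_rectangle_le: "diameter V \<le> 3 * H"
proof -
  have norm: "norm (u - v) \<le> 3 * H" if "u \<in> V" "v \<in> V" for u v
    using V[OF that(1)] V[OF that(2)] cmod_le[of "u - v"] by auto
  then show "bounded V"
    unfolding bounded_two_points dist_norm by blast
  show "diameter V \<le> 3 * H"
    by (rule diameter_le) (use norm \<open>0 \<le> H\<close> in auto)
qed

lemma exists_multiple_interval:
  fixes x :: real
  assumes "0 \<le> x" "x \<le> M" "0 < H"
  shows "\<exists>i\<le>nat \<lfloor>M / H\<rfloor>. real i * H \<le> x \<and> x \<le> real i * H + H"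
proof -
  define i where "i = nat \<lfloor>x / H\<rfloor>"
  have quotient: "0 \<le> x / H" "x / H \<le> M / H"
    using assms by (auto simp: divide_right_mono)
  then have "real i \<le> x / H" "x / H \<le> real i + 1"
    unfolding i_def by linarith+
  moreover have "i \<le> nat \<lfloor>M / H\<rfloor>"
    unfolding i_def using quotient(2) by (intro nat_mono floor_mono)
  ultimately show ?thesis
    using assms(3) by (intro exI[of _ i]) (auto simp: field_simps)
qed

lemma gauge_content_lipschitz_image_strip:
  fixes g :: "complex \<Rightarrow> 'a::metric_space"
  assumes h: "starshaped_gauge r h" and g: "c-lipschitz_on S g"
    and S: "\<And>w. w \<in> S \<Longrightarrow> 0 \<le> Re w \<and> Re w \<le> M \<and> \<bar>Im w\<bar> \<le> H" and "0 < H" "0 \<le> M"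
    and \<delta>: "3 * c * H < \<delta>" "\<delta> \<le> r"
  shows "gauge_content h \<delta> (g ` S) \<le> ennreal ((M / H + 1) * h (3 * c * H))"
proof -
  have "0 \<le> c"
    using g by (rule lipschitz_on_nonneg)
  define V where "V i = {w \<in> S. real i * H \<le> Re w \<and> Re w \<le> real i * H + H}" for i
  define n where "n = nat \<lfloor>M / H\<rfloor>"
  have in_V: "real i * H \<le> Re w \<and> Re w \<le> real i * H + H \<and> \<bar>Im w\<bar> \<le> H" if "w \<in> V i" for w i
    using that S by (simp add: V_def)
  have V: "bounded (V i)" "diameter (V i) \<le> 3 * H" for i
    using bounded_rectangle[OF in_V] diameter_rectangle_le[OF in_V] \<open>0 < H\<close> by auto
  have "g ` S \<subseteq> (\<Union>i\<in>{..n}. g ` V i)"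
  proof (rule image_subsetI)
    fix w assume "w \<in> S"
    then show "g w \<in> (\<Union>i\<in>{..n}. g ` V i)"
      using exists_multiple_interval[of "Re w" M H] S \<open>0 < H\<close> by (auto simp: V_def n_def)
  qed
  moreover have "gauge_content h \<delta> (g ` V i) \<le> ennreal (h (3 * c * H))" for i
  proof (rule gauge_content_le_diameter[OF h _ _ \<delta>])
    have lip: "c-lipschitz_on (V i) g"
      using g by (rule lipschitz_on_subset) (auto simp: V_def)
    show "bounded (g ` V i)"
      using lip V(1) by (rule bounded_lipschitz_image)
    show "diameter (g ` V i) \<le> 3 * c * H"
      using diameter_lipschitz_image_le[OF lip V(1)] mult_left_mono[OF V(2)[of i] \<open>0 \<le> c\<close>] by simp
  qed
  moreover have "0 < \<delta>"
    using \<delta>(1) \<open>0 \<le> c\<close> \<open>0 < H\<close> by (simp add: le_less_trans[rotated])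
  ultimately have "gauge_content h \<delta> (g ` S) \<le> of_nat (card {..n}) * ennreal (h (3 * c * H))"
    by (intro gauge_content_finite_cover starshaped_gauge_0[OF h]) auto
  also have "\<dots> = ennreal (real (card {..n}) * h (3 * c * H))"
    by (simp add: ennreal_mult' ennreal_of_nat_eq_real_of_nat)
  also have "\<dots> \<le> ennreal ((M / H + 1) * h (3 * c * H))"
  proof (intro ennreal_leI mult_right_mono starshaped_gauge_nonneg[OF h])
    show "real (card {..n}) \<le> M / H + 1"
      using \<open>0 < H\<close> \<open>0 \<le> M\<close> by (simp add: n_def)
  qed (use \<delta> \<open>0 \<le> c\<close> \<open>0 < H\<close> in auto)
  finally show ?thesis .
qed

definition unit_box :: "real \<Rightarrow> real \<Rightarrow> complex set" where
  "unit_box a b = cbox (Complex a b) (Complex (a + 1) (b + 1))"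

lemma in_unit_box_iff:
  "z \<in> unit_box a b \<longleftrightarrow> a \<le> Re z \<and> Re z \<le> a + 1 \<and> b \<le> Im z \<and> Im z \<le> b + 1"
  by (auto simp: unit_box_def in_cbox_complex_iff)

lemma in_unit_box_floor: "z \<in> unit_box (of_int \<lfloor>Re z\<rfloor>) (of_int \<lfloor>Im z\<rfloor>)"
  by (simp add: in_unit_box_iff)

lemma gauge_content_le_unit_boxes:
  assumes "h 0 = 0" "0 < \<delta>" "1 \<le> M" "0 \<le> e" and S: "S \<subseteq> cball 0 M"
    and box: "\<And>a b. S \<inter> unit_box a b \<noteq> {} \<Longrightarrow> gauge_content h \<delta> (S \<inter> unit_box a b) \<le> ennreal e"
  shows "gauge_content h \<delta> S \<le> ennreal (16 * M\<^sup>2 * e)"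
proof -
  define Q where "Q = (\<lambda>(m, n). S \<inter> unit_box (real_of_int m) (real_of_int n))"
  define I where "I = {\<lfloor>- M\<rfloor>..\<lfloor>M\<rfloor>}"
  have "S \<subseteq> (\<Union>p\<in>I \<times> I. Q p)"
  proof
    fix w assume "w \<in> S"
    then have "- M \<le> Re w" "Re w \<le> M" "- M \<le> Im w" "Im w \<le> M"
      using S abs_Re_le_cmod[of w] abs_Im_le_cmod[of w] by force+
    then have "\<lfloor>Re w\<rfloor> \<in> I" "\<lfloor>Im w\<rfloor> \<in> I"
      unfolding I_def atLeastAtMost_iff by (auto intro!: floor_mono)
    then show "w \<in> (\<Union>p\<in>I \<times> I. Q p)"
      using \<open>w \<in> S\<close> in_unit_box_floor[of w]
      by (intro UN_I[of "(\<lfloor>Re w\<rfloor>, \<lfloor>Im w\<rfloor>)"]) (auto simp: Q_def)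
  qed
  moreover have "gauge_content h \<delta> (Q p) \<le> ennreal e" for p
    using box assms(1,2) by (cases "Q p = {}") (auto simp: Q_def split: prod.splits)
  ultimately have "gauge_content h \<delta> S \<le> of_nat (card (I \<times> I)) * ennreal e"
    by (intro gauge_content_finite_cover[where h = h] assms(1,2)) (auto simp: I_def)
  also have "\<dots> = ennreal (real (card (I \<times> I)) * e)"
    using \<open>0 \<le> e\<close> by (simp add: ennreal_mult' ennreal_of_nat_eq_real_of_nat)
  also have "\<dots> \<le> ennreal (16 * M\<^sup>2 * e)"
  proof (intro ennreal_leI mult_right_mono \<open>0 \<le> e\<close>)
    have "real (card I) \<le> 4 * M"
      using \<open>1 \<le> M\<close> unfolding I_def by (simp; linarith)
    then have "real (card I) * real (card I) \<le> (4 * M) * (4 * M)"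
      using \<open>1 \<le> M\<close> by (intro mult_mono) auto
    then show "real (card (I \<times> I)) \<le> 16 * M\<^sup>2"
      by (simp add: card_cartesian_product power2_eq_square)
  qed
  finally show ?thesis .
qed

section \<open>Sets of gauge measure zero\<close>

lemma hausdorff_gauge_eq_0_iff:
  "hausdorff_gauge h A = 0 \<longleftrightarrow> (\<forall>\<delta>>0. gauge_content h \<delta> A = 0)"
  by (auto simp: hausdorff_gauge_def SUP_bot_conv simp flip: bot_ennreal gauge_content_def)

lemma hausdorff_gauge_eq_0_subset:
  assumes "hausdorff_gauge h B = 0" "A \<subseteq> B"
  shows "hausdorff_gauge h A = 0"
  using gauge_content_mono[OF assms(2) order_refl, of h] assms(1)
  by (auto simp: hausdorff_gauge_eq_0_iff) (metis le_zero_eq)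

lemma hausdorff_gauge_eq_0_countable_UN:
  assumes h: "h 0 = 0" and I: "countable I" and S: "\<And>i. i \<in> I \<Longrightarrow> hausdorff_gauge h (S i) = 0"
  shows "hausdorff_gauge h (\<Union>i\<in>I. S i) = 0"
proof (cases "I = {}")
  case True
  then show ?thesis
    using h by (simp add: hausdorff_gauge_eq_0_iff)
next
  case False
  have "(\<Union>i\<in>I. S i) = (\<Union>n. S (from_nat_into I n))"
    using range_from_nat_into[OF False I] by (metis image_image)
  moreover have "gauge_content h \<delta> (S (from_nat_into I n)) = 0" if "0 < \<delta>" for \<delta> n
    using S[OF from_nat_into[OF False]] that by (simp add: hausdorff_gauge_eq_0_iff)
  then have "gauge_content h \<delta> (\<Union>n. S (from_nat_into I n)) = 0" if "0 < \<delta>" for \<delta>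
    using gauge_content_UN[of h \<delta> "\<lambda>n. S (from_nat_into I n)"] that by simp
  ultimately show ?thesis
    by (simp add: hausdorff_gauge_eq_0_iff)
qed

lemma hausdorff_gauge_eq_0_unit_boxes:
  assumes "h 0 = 0"
    and "\<And>m n :: int. hausdorff_gauge h (S \<inter> unit_box (of_int m) (of_int n)) = 0"
  shows "hausdorff_gauge h S = 0"
proof (rule hausdorff_gauge_eq_0_subset)
  show "hausdorff_gauge h (\<Union>p. S \<inter> unit_box (of_int (fst p)) (of_int (snd p))) = 0"
    by (intro hausdorff_gauge_eq_0_countable_UN assms) auto
  show "S \<subseteq> (\<Union>p. S \<inter> unit_box (of_int (fst p)) (of_int (snd p)))"
    using in_unit_box_floor by fastforce
qed

lemma hausdorff_gauge_eq_0_lipschitz_image: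
  assumes g: "1-lipschitz_on S g" and h: "starshaped_gauge r h" "0 < r"
    and S: "hausdorff_gauge h S = 0"
  shows "hausdorff_gauge h (g ` S) = 0"
  unfolding hausdorff_gauge_eq_0_iff
proof (intro allI impI)
  fix \<delta> :: real assume "0 < \<delta>"
  have "gauge_content h \<delta> (g ` S) \<le> gauge_content h (min \<delta> r) (g ` S)"
    by (rule gauge_content_mono) auto
  also have "\<dots> \<le> gauge_content h (min \<delta> r) S"
    using gauge_content_lipschitz_image[OF g h(1), of "min \<delta> r"] by simp
  also have "\<dots> = 0"
    using S \<open>0 < \<delta>\<close> h(2) by (simp add: hausdorff_gauge_eq_0_iff)
  finally show "gauge_content h \<delta> (g ` S) = 0"
    by simp
qed

lemma hausdorff_gauge_eq_0_sequentially:
  assumes content: "\<And>n. gauge_content h (d n) S \<le> ennreal (e n)"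
    and d: "d \<longlonglongrightarrow> 0" and e: "e \<longlonglongrightarrow> 0"
  shows "hausdorff_gauge h S = 0"
  unfolding hausdorff_gauge_eq_0_iff
proof (intro allI impI)
  fix \<delta> :: real assume "0 < \<delta>"
  have "eventually (\<lambda>n. d n < \<delta>) sequentially"
    using d \<open>0 < \<delta>\<close> by (rule order_tendstoD)
  then have "eventually (\<lambda>n. gauge_content h \<delta> S \<le> ennreal (e n)) sequentially"
    by eventually_elim (rule order_trans[OF gauge_content_mono content]; simp)
  moreover have "(\<lambda>n. ennreal (e n)) \<longlonglongrightarrow> ennreal 0"
    using e by (rule tendsto_ennrealI)
  ultimately have "gauge_content h \<delta> S \<le> ennreal 0"
    by (intro tendsto_lowerbound) auto
  then show "gauge_content h \<delta> S = 0"
    by simp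
qed

definition log_gauge :: "real \<Rightarrow> real \<Rightarrow> real" where
  "log_gauge s = (\<lambda>t. t / ln (1 / t) powr s)"

lemma starshaped_log_gauge:
  assumes "0 \<le> s"
  shows "starshaped_gauge 1 (log_gauge s)"
  unfolding starshaped_gauge_def
proof (intro conjI ballI mono_onI)
  fix t u :: real assume tu: "t \<in> {0<..<1}" "u \<in> {0<..<1}" "t \<le> u"
  then have "0 < ln (1 / u)" "ln (1 / u) \<le> ln (1 / t)"
    by (auto simp: frac_le)
  then have "0 < ln (1 / u) powr s" "ln (1 / u) powr s \<le> ln (1 / t) powr s"
    using assms by (auto intro: powr_mono2)
  then show "log_gauge s t / t \<le> log_gauge s u / u"
    using tu by (simp add: log_gauge_def frac_le)
qed (auto simp: log_gauge_def)

section \<open>Normality of iterates\<close>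

lemma uniform_limit_funpow_contraction:
  fixes f :: "'a::metric_space \<Rightarrow> 'a"
  assumes S: "complete S" "S \<noteq> {}" "bounded S" and f: "c-lipschitz_on S f" "c < 1" "f ` S \<subseteq> S"
  obtains a where "uniform_limit S (\<lambda>n. f ^^ n) (\<lambda>_. a) sequentially"
proof -
  have "0 \<le> c"
    using f(1) by (rule lipschitz_on_nonneg)
  then obtain a where a: "a \<in> S" "f a = a"
    using Banach_fix[OF S(1,2) _ f(2,3) lipschitz_onD[OF f(1)]] by blast
  have bound: "(f ^^ n) x \<in> S \<and> dist ((f ^^ n) x) a \<le> c ^ n * diameter S" if "x \<in> S" for n x
  proof (induction n)
    case 0
    then show ?case
      using that a(1) S(3) by (simp add: diameter_bounded_bound)
  next
    case (Suc n)
    then have "dist (f ((f ^^ n) x)) (f a) \<le> c * (c ^ n * diameter S)"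
      using lipschitz_onD[OF f(1), of "(f ^^ n) x" a] a(1) \<open>0 \<le> c\<close>
      by (meson mult_left_mono order_trans)
    then show ?case
      using Suc f(3) a(2) by auto
  qed
  have bound_tendsto: "(\<lambda>n. c ^ n * diameter S) \<longlonglongrightarrow> 0"
    using \<open>0 \<le> c\<close> f(2) by (intro tendsto_mult_left_zero LIMSEQ_power_zero) simp
  have "uniform_limit S (\<lambda>n. f ^^ n) (\<lambda>_. a) sequentially"
  proof (intro uniform_limitI)
    fix e :: real assume "0 < e"
    then have "eventually (\<lambda>n. c ^ n * diameter S < e) sequentially"
      by (rule order_tendstoD(2)[OF bound_tendsto])
    then show "eventually (\<lambda>n. \<forall>x\<in>S. dist ((f ^^ n) x) a < e) sequentially"
      by eventually_elim (use bound in \<open>blast intro: le_less_trans\<close>)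
  qed
  then show thesis
    by (rule that)
qed

lemma uniform_limit_imp_normal_at:
  assumes "open U" "z \<in> U" and lim: "uniform_limit U (\<lambda>n. f ^^ n) g sequentially"
  shows "normal_at f z"
  unfolding normal_at_def
proof (intro exI[of _ U] conjI allI impI assms(1,2))
  fix r :: "nat \<Rightarrow> nat" assume "strict_mono r"
  then have "uniform_limit U (\<lambda>n. f ^^ r n) g sequentially"
    by (intro filterlim_compose[OF lim] filterlim_subseq)
  then have "\<forall>K. compact K \<and> K \<subseteq> U \<longrightarrow> uniform_limit K (\<lambda>n. f ^^ r (id n)) g sequentially"
    by (auto intro: uniform_limit_on_subset)
  then show "\<exists>q. strict_mono q \<and>
      ((\<exists>g. \<forall>K. compact K \<and> K \<subseteq> U \<longrightarrow> uniform_limit K (\<lambda>n. f ^^ r (q n)) g sequentially) \<or>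
       (\<forall>K. compact K \<and> K \<subseteq> U \<longrightarrow> (\<forall>M. \<forall>\<^sub>F n in sequentially. \<forall>x\<in>K. M \<le> norm ((f ^^ r (q n)) x))))"
    by (intro exI[of _ id]) (auto simp: strict_mono_def)
qed

lemma normal_at_imp_cball_subsequence:
  assumes "normal_at f z"
  obtains \<rho> q where "0 < \<rho>" "strict_mono q"
    "(\<exists>g. uniform_limit (cball z \<rho>) (\<lambda>n. f ^^ q n) g sequentially) \<or>
     (\<forall>M. \<forall>\<^sub>F n in sequentially. \<forall>x\<in>cball z \<rho>. M \<le> norm ((f ^^ q n) x))"
proof -
  obtain U where U: "open U" "z \<in> U" and sub: "\<And>r :: nat \<Rightarrow> nat. strict_mono r \<Longrightarrow> \<exists>q. strict_mono q \<and>
      ((\<exists>g. \<forall>K. compact K \<and> K \<subseteq> U \<longrightarrow> uniform_limit K (\<lambda>n. f ^^ r (q n)) g sequentially) \<or>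
       (\<forall>K. compact K \<and> K \<subseteq> U \<longrightarrow> (\<forall>M. \<forall>\<^sub>F n in sequentially. \<forall>x\<in>K. M \<le> norm ((f ^^ r (q n)) x))))"
    using assms unfolding normal_at_def by blast
  obtain \<rho> where \<rho>: "0 < \<rho>" "cball z \<rho> \<subseteq> U"
    using U open_contains_cball by blast
  then have K: "compact (cball z \<rho>) \<and> cball z \<rho> \<subseteq> U"
    by simp
  obtain q :: "nat \<Rightarrow> nat" where q: "strict_mono q" and
    "(\<exists>g. \<forall>K. compact K \<and> K \<subseteq> U \<longrightarrow> uniform_limit K (\<lambda>n. f ^^ q n) g sequentially) \<or>
     (\<forall>K. compact K \<and> K \<subseteq> U \<longrightarrow> (\<forall>M. \<forall>\<^sub>F n in sequentially. \<forall>x\<in>K. M \<le> norm ((f ^^ q n) x)))"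
    using sub[OF strict_mono_id] unfolding id_apply by blast
  then have "(\<exists>g. uniform_limit (cball z \<rho>) (\<lambda>n. f ^^ q n) g sequentially) \<or>
     (\<forall>M. \<forall>\<^sub>F n in sequentially. \<forall>x\<in>cball z \<rho>. M \<le> norm ((f ^^ q n) x))"
    by (elim disj_forward) (use K in fast)+
  then show thesis
    by (rule that[OF \<rho>(1) q])
qed

section \<open>Estimates in the complex plane\<close>

lemma lipschitz_on_field_derivative_bound:
  fixes f :: "'a::real_normed_field \<Rightarrow> 'a"
  assumes "convex S" "\<And>z. z \<in> S \<Longrightarrow> (f has_field_derivative f' z) (at z within S)"
    and "\<And>z. z \<in> S \<Longrightarrow> norm (f' z) \<le> c" "0 \<le> c"
  shows "c-lipschitz_on S f"
  using field_differentiable_bound[OF assms(1-3)] assms(4)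
  by (auto intro!: lipschitz_onI simp: dist_norm)

lemma norm_le_norm_plus_Re_Im:
  assumes "0 \<le> Re u" "Re u \<le> Re v + d" "0 \<le> d"
  shows "norm u \<le> norm v + d + \<bar>Im u - Im v\<bar>"
proof -
  define p where "p = Complex (Re u) (Im v)"
  have "norm p \<le> norm (v + of_real d)"
    unfolding cmod_def p_def using assms by (auto intro!: real_sqrt_le_mono power_mono)
  also have "\<dots> \<le> norm v + d"
    using norm_triangle_ineq[of v "of_real d"] assms(3) by simp
  finally have "norm p \<le> norm v + d" .
  moreover have "norm (u - p) = \<bar>Im u - Im v\<bar>"
    by (simp add: cmod_def p_def)
  ultimately show ?thesis
    using norm_triangle_sub[of u p] by linarith
qed

lemma norm_plus_le_norm_add_of_real:
  fixes w :: complex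
  assumes "0 \<le> Re w" "0 \<le> x"
  shows "norm w + x \<le> 2 * norm (w + of_real x)"
proof -
  have "norm w \<le> norm (w + of_real x)"
    unfolding cmod_def using assms by (auto intro!: real_sqrt_le_mono power_mono)
  moreover have "x \<le> norm (w + of_real x)"
    using assms complex_Re_le_cmod[of "w + of_real x"] by simp
  ultimately show ?thesis
    by simp
qed

lemma norm_Ln_add_norm_le:
  assumes "0 < Re w" "0 \<le> t"
  shows "norm (Ln (w + of_real (norm w * (exp t - 1))) - Ln w - of_real t) \<le> 5"
proof -
  define x where "x = norm w * (exp t - 1)"
  define v where "v = w + of_real x"
  have "0 \<le> x"
    using assms by (simp add: x_def)
  then have "0 < Re v"
    using assms by (simp add: v_def)
  then have pos: "0 < norm w" "0 < norm v"
    using assms by auto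
  have norm_w_plus: "norm w + x = exp t * norm w"
    by (simp add: x_def algebra_simps)
  have "norm v \<le> exp t * norm w" "exp t * norm w \<le> 2 * norm v"
    using norm_triangle_ineq[of w "of_real x"] norm_plus_le_norm_add_of_real[of w x] assms \<open>0 \<le> x\<close>
    unfolding v_def norm_w_plus[symmetric] by auto
  then have "ln (norm v) \<le> ln (exp t * norm w)" "ln (exp t * norm w) \<le> ln (2 * norm v)"
    using pos by auto
  then have "ln (norm v) \<le> t + ln (norm w)" "t + ln (norm w) \<le> 1 + ln (norm v)"
    using pos ln_2_less_1 by (simp_all add: ln_mult)
  then have "\<bar>Re (Ln v - Ln w - of_real t)\<bar> \<le> 1"
    using pos by simp
  moreover have "\<bar>Im (Ln v - Ln w - of_real t)\<bar> < pi"
    using Re_Ln_pos_lt_imp[OF assms(1)] Re_Ln_pos_lt_imp[OF \<open>0 < Re v\<close>] by (simp; linarith)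
  ultimately have "norm (Ln v - Ln w - of_real t) \<le> 5"
    using cmod_le[of "Ln v - Ln w - of_real t"] pi_less_4 by linarith
  then show ?thesis
    by (simp add: v_def x_def)
qed

section \<open>The Julia set\<close>

locale exp_family =
  fixes lam :: real
  assumes lam_pos: "0 < lam" and lam_less: "lam < 1 / exp 1"
begin

abbreviation E :: "complex \<Rightarrow> complex" where
  "E \<equiv> expmap lam"

definition B :: real where
  "B = - ln lam"

lemma B_gt_1: "1 < B"
proof -
  have "ln lam < ln (1 / exp 1)"
    using lam_pos lam_less by (subst ln_less_cancel_iff) auto
  then show ?thesis
    by (simp add: B_def ln_div)
qed

lemma filterlim_B_power: "filterlim (\<lambda>n. B ^ n) at_top sequentially"
  using B_gt_1 by real_asymp

lemma E_eq_exp: "E z = exp (z - of_real B)"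
proof -
  have "exp B = inverse lam"
    using lam_pos by (simp add: B_def exp_minus)
  then have "exp (of_real B :: complex) = of_real (inverse lam)"
    by (simp only: exp_of_real)
  then show ?thesis
    by (simp add: expmap_def exp_diff field_simps)
qed

lemma norm_E: "norm (E z) = exp (Re z - B)"
  by (simp add: E_eq_exp)

lemma Re_E: "Re (E z) = exp (Re z - B) * cos (Im z)"
  by (simp add: E_eq_exp Re_exp)

lemma has_field_derivative_E: "(E has_field_derivative E z) (at z within S)"
  unfolding E_eq_exp[abs_def] by (auto intro!: derivative_eq_intros)

lemma has_field_derivative_E_iter:
  "((E ^^ n) has_field_derivative (\<Prod>k<n. (E ^^ Suc k) z)) (at z)"
proof (induction n)
  case (Suc n)
  have "((\<lambda>z. E ((E ^^ n) z)) has_field_derivative (E ((E ^^ n) z) * (\<Prod>k<n. (E ^^ Suc k) z))) (at z)"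
    by (rule DERIV_chain2[OF has_field_derivative_E Suc])
  then show ?case
    by (simp add: comp_def mult.commute)
qed (auto simp: id_def)

lemma holomorphic_on_E_iter: "(E ^^ n) holomorphic_on S"
  unfolding holomorphic_on_def field_differentiable_def
  using has_field_derivative_at_within[OF has_field_derivative_E_iter] by blast

lemma continuous_on_E_iter: "continuous_on S (E ^^ n)"
  by (rule holomorphic_on_imp_continuous_on[OF holomorphic_on_E_iter])

definition trapped :: "complex set" where
  "trapped = {z. \<forall>n. B \<le> Re ((E ^^ n) z)}"

lemma trapped_Re_ge: "z \<in> trapped \<Longrightarrow> B \<le> Re z"
  by (auto simp: trapped_def dest: spec[of _ 0])

lemma trapped_iter: "z \<in> trapped \<Longrightarrow> (E ^^ n) z \<in> trapped"
  by (simp add: trapped_def flip: funpow_add comp_apply[of "E ^^ _" "E ^^ n"])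

lemma trapped_E: "z \<in> trapped \<Longrightarrow> E z \<in> trapped"
  using trapped_iter[of z 1] by simp

lemma norm_deriv_E_iter_ge:
  assumes "z \<in> trapped"
  shows "B ^ n \<le> norm (deriv (E ^^ n) z)"
proof -
  have "B \<le> norm ((E ^^ k) z)" for k
    using trapped_Re_ge[OF trapped_iter[OF assms]] complex_Re_le_cmod by (rule order_trans)
  then have "(\<Prod>k<n. B) \<le> (\<Prod>k<n. norm ((E ^^ Suc k) z))"
    using B_gt_1 by (intro prod_mono conjI) (auto simp del: funpow.simps)
  then show ?thesis
    using DERIV_imp_deriv[OF has_field_derivative_E_iter] by (simp add: prod_norm)
qed

lemma norm_E_less_1: "Re z < B \<Longrightarrow> norm (E z) < 1"
  by (simp add: norm_E)

lemma norm_E_iter_less_1: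
  assumes "Re ((E ^^ n) z) < B" "n < m"
  shows "norm ((E ^^ m) z) < 1"
  using Suc_leI[OF assms(2)]
proof (induction rule: dec_induct)
  case base
  show ?case
    using assms(1) by (simp add: norm_E_less_1)
next
  case (step m)
  then have "Re ((E ^^ m) z) < B"
    using complex_Re_le_cmod[of "(E ^^ m) z"] B_gt_1 by linarith
  then show ?case
    by (simp add: norm_E_less_1)
qed

lemma lipschitz_on_E_unit_disc: "(exp (1 - B))-lipschitz_on (cball 0 1) E"
proof (rule lipschitz_on_field_derivative_bound[OF _ has_field_derivative_E])
  fix z :: complex assume "z \<in> cball 0 1"
  then show "norm (E z) \<le> exp (1 - B)"
    using complex_Re_le_cmod[of z] by (simp add: norm_E)
qed auto

lemma not_trapped_imp_normal_at:
  assumes "z \<notin> trapped"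
  shows "normal_at E z"
proof -
  obtain n where n: "Re ((E ^^ n) z) < B"
    using assms by (auto simp: trapped_def not_le)
  define U where "U = {w. Re ((E ^^ n) w) < B}"
  have maps: "E ` cball 0 1 \<subseteq> cball 0 1"
  proof (rule image_subsetI)
    fix w :: complex assume "w \<in> cball 0 1"
    then have "Re w < B"
      using complex_Re_le_cmod[of w] B_gt_1 by simp
    then show "E w \<in> cball 0 1"
      using norm_E_less_1[of w] by simp
  qed
  obtain a where lim: "uniform_limit (cball 0 1) (\<lambda>k. E ^^ k) (\<lambda>_. a) sequentially"
    by (rule uniform_limit_funpow_contraction[OF _ _ _ lipschitz_on_E_unit_disc _ maps])
      (use B_gt_1 in \<open>auto simp: compact_imp_complete\<close>)
  have "E ^^ Suc n \<in> U \<rightarrow> cball 0 1"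
    using norm_E_iter_less_1[of n _ "Suc n", THEN less_imp_le] by (auto simp: U_def)
  from uniform_limit_compose'[OF lim this]
  have "uniform_limit U (\<lambda>k w. (E ^^ k) ((E ^^ Suc n) w)) (\<lambda>_. a) sequentially" .
  then have "\<forall>\<^sub>F k in sequentially. \<forall>w\<in>U. dist ((E ^^ (k + Suc n)) w) a < e" if "0 < e" for e
    using that unfolding uniform_limit_iff funpow_add comp_apply by blast
  then have "uniform_limit U (\<lambda>k. E ^^ k) (\<lambda>_. a) sequentially"
    by (subst (asm) eventually_sequentially_seg) (rule uniform_limitI)
  moreover have "open U"
    unfolding U_def by (intro open_Collect_less continuous_intros continuous_on_E_iter)
  moreover have "z \<in> U"
    using n by (simp add: U_def)
  ultimately show ?thesis
    by (intro uniform_limit_imp_normal_at)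
qed

lemma exists_Re_E_neg: "\<exists>w\<in>ball b 4. Re (E w) < 0"
proof -
  define k where "k = \<lfloor>Im b / (2 * pi)\<rfloor>"
  define y where "y = 2 * pi * of_int k + pi"
  have "of_int k \<le> Im b / (2 * pi)" "Im b / (2 * pi) \<le> of_int k + 1"
    unfolding k_def by linarith+
  then have "2 * pi * of_int k \<le> Im b" "Im b \<le> 2 * pi * of_int k + 2 * pi"
    by (simp_all add: field_simps)
  then have "\<bar>Im b - y\<bar> < 4"
    using pi_less_4 unfolding y_def by linarith
  then have "Complex (Re b) y \<in> ball b 4"
    by (simp add: dist_norm cmod_def)
  moreover have "cos y = - 1"
    by (simp add: y_def cos_add)
  then have "Re (E (Complex (Re b) y)) < 0"
    by (simp add: Re_E)
  ultimately show ?thesis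
    by blast
qed

lemma interior_trapped: "interior trapped = {}"
proof (rule equals0I)
  fix z assume "z \<in> interior trapped"
  then obtain \<rho> where \<rho>: "0 < \<rho>" "ball z \<rho> \<subseteq> trapped"
    by (auto simp: mem_interior)
  then have z: "z \<in> trapped"
    by auto
  obtain n where "48 / \<rho> < B ^ n"
    using filterlim_B_power by (auto simp: filterlim_at_top_dense eventually_sequentially)
  also have "\<dots> \<le> norm (deriv (E ^^ n) z)"
    using z by (rule norm_deriv_E_iter_ge)
  finally have "4 \<le> \<rho> * norm (deriv (E ^^ n) z) / 12"
    using \<rho>(1) by (simp add: field_simps)
  then obtain b where "ball b 4 \<subseteq> (E ^^ n) ` ball z \<rho>"
    using \<rho>(1) by (elim Bloch_general[OF holomorphic_on_E_iter, rotated -1]) auto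
  then obtain w where "w \<in> ball z \<rho>" "Re (E ((E ^^ n) w)) < 0"
    using exists_Re_E_neg[of b] by blast
  moreover have "E ((E ^^ n) w) \<in> trapped"
    using \<rho>(2) \<open>w \<in> ball z \<rho>\<close> by (intro trapped_E trapped_iter) auto
  ultimately show False
    using trapped_Re_ge[of "E ((E ^^ n) w)"] B_gt_1 by linarith
qed

lemma not_uniform_limit_E_iter_trapped:
  assumes z: "z \<in> trapped" and "0 < \<rho>" and q: "strict_mono q"
  shows "\<not> uniform_limit (cball z \<rho>) (\<lambda>n. E ^^ q n) g sequentially"
proof
  assume lim: "uniform_limit (cball z \<rho>) (\<lambda>n. E ^^ q n) g sequentially"
  have "((E ^^ n) has_field_derivative deriv (E ^^ n) w) (at w)" for n w
    using has_field_derivative_E_iter DERIV_imp_deriv by metis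
  then have "\<forall>\<^sub>F n in sequentially. continuous_on (cball z \<rho>) (E ^^ q n) \<and>
      (\<forall>w\<in>ball z \<rho>. ((E ^^ q n) has_field_derivative deriv (E ^^ q n) w) (at w))"
    by (simp add: continuous_on_E_iter)
  from has_complex_derivative_uniform_limit[OF this lim _ \<open>0 < \<rho>\<close>]
  obtain g' where "(\<lambda>n. deriv (E ^^ q n) z) \<longlonglongrightarrow> g' z"
    using \<open>0 < \<rho>\<close> by (metis centre_in_ball sequentially_bot)
  moreover have "filterlim (\<lambda>n. B ^ q n) at_top sequentially"
    by (rule filterlim_compose[OF filterlim_B_power filterlim_subseq[OF q]])
  then have "filterlim (\<lambda>n. norm (deriv (E ^^ q n) z)) at_top sequentially"
    by (rule filterlim_at_top_mono) (simp add: norm_deriv_E_iter_ge[OF z])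
  ultimately show False
    using not_tendsto_and_filterlim_at_infinity[OF sequentially_bot]
    by (auto simp: filterlim_at_infinity_conv_norm_at_top)
qed

lemma trapped_imp_not_normal_at:
  assumes z: "z \<in> trapped"
  shows "\<not> normal_at E z"
proof
  assume "normal_at E z"
  then obtain \<rho> q where \<rho>: "0 < \<rho>" and q: "strict_mono q" and
    "(\<exists>g. uniform_limit (cball z \<rho>) (\<lambda>n. E ^^ q n) g sequentially) \<or>
     (\<forall>M. \<forall>\<^sub>F n in sequentially. \<forall>x\<in>cball z \<rho>. M \<le> norm ((E ^^ q n) x))"
    by (rule normal_at_imp_cball_subsequence)
  then consider (finite) g where "uniform_limit (cball z \<rho>) (\<lambda>n. E ^^ q n) g sequentially"
    | (infinite) "\<And>M. \<forall>\<^sub>F n in sequentially. \<forall>x\<in>cball z \<rho>. M \<le> norm ((E ^^ q n) x)"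
    by blast
  then show False
  proof cases
    case finite
    then show False
      using not_uniform_limit_E_iter_trapped[OF z \<rho> q] by blast
  next
    case infinite
    have "\<not> ball z \<rho> \<subseteq> trapped"
      using interior_trapped interior_maximal[of "ball z \<rho>" trapped] \<rho> by auto
    then obtain w where "w \<in> cball z \<rho>" "w \<notin> trapped"
      using ball_subset_cball by blast
    then obtain n where w: "w \<in> cball z \<rho>" "Re ((E ^^ n) w) < B"
      by (auto simp: trapped_def not_le)
    have "\<forall>\<^sub>F m in sequentially. norm ((E ^^ q m) w) < 1"
      using eventually_gt_at_top[of n]
      by eventually_elim (meson norm_E_iter_less_1 w(2) less_le_trans seq_suble q)
    moreover have "\<forall>\<^sub>F m in sequentially. 1 \<le> norm ((E ^^ q m) w)"
      using infinite[of 1] by eventually_elim (use w(1) in blast)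
    ultimately have "\<forall>\<^sub>F m in sequentially. False"
      by eventually_elim simp
    then show False
      by simp
  qed
qed

lemma julia_set_eq_trapped: "julia_set E = trapped"
  using trapped_imp_not_normal_at not_trapped_imp_normal_at
  by (auto simp: julia_set_def fatou_set_def)

section \<open>Inverse branches and itineraries\<close>

definition inv_branch :: "int \<Rightarrow> complex \<Rightarrow> complex" where
  "inv_branch k w = Ln w + of_real B + \<i> * (of_int k * (of_real pi * 2))"

lemma E_inv_branch: "w \<noteq> 0 \<Longrightarrow> E (inv_branch k w) = w"
  by (simp add: E_eq_exp inv_branch_def exp_add exp_diff)

lemma inv_branch_E:
  assumes "- pi < Im z - 2 * pi * of_int k" "Im z - 2 * pi * of_int k \<le> pi"
  shows "inv_branch k (E z) = z"
proof -
  define u where "u = z - of_real B - \<i> * (of_int k * (of_real pi * 2))"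
  have "E z = exp (u + \<i> * (of_int k * (of_real pi * 2)))"
    by (simp add: E_eq_exp u_def)
  then have "E z = exp u"
    by (simp only: exp_plus_2pin)
  moreover have "Ln (exp u) = u"
    using assms by (intro Ln_exp) (auto simp: u_def mult_ac)
  ultimately show ?thesis
    by (simp add: inv_branch_def u_def)
qed

lemma Im_inv_branch_near: "0 < Re w \<Longrightarrow> \<bar>Im (inv_branch k w) - 2 * pi * of_int k\<bar> < pi / 2"
  using Re_Ln_pos_lt_imp[of w] by (simp add: inv_branch_def mult_ac)

lemma Re_inv_branch_ge:
  assumes "B \<le> Re w"
  shows "B \<le> Re (inv_branch k w)"
proof -
  have "1 \<le> norm w" "w \<noteq> 0"
    using assms B_gt_1 complex_Re_le_cmod[of w] by auto
  then show ?thesis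
    by (simp add: inv_branch_def)
qed

lemma lipschitz_on_inv_branch:
  assumes "0 < r"
  shows "(1 / r)-lipschitz_on {z. r \<le> Re z} (inv_branch k)"
proof (rule lipschitz_on_field_derivative_bound[where f' = "\<lambda>z. 1 / z"])
  show "convex {z. r \<le> Re z}"
    by (rule convex_halfspace_Re_ge)
  fix z assume "z \<in> {z. r \<le> Re z}"
  then have z: "r \<le> Re z" "r \<le> norm z" "z \<notin> \<real>\<^sub>\<le>\<^sub>0"
    using assms complex_Re_le_cmod[of z] by (auto simp: complex_nonpos_Reals_iff)
  show "(inv_branch k has_field_derivative 1 / z) (at z within {z. r \<le> Re z})"
    unfolding inv_branch_def[abs_def]
    using z(3) by (auto intro!: derivative_eq_intros simp: field_simps)
  show "norm (1 / z) \<le> 1 / r"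
    using z(2) assms by (simp add: norm_divide frac_le)
qed (use assms in auto)

abbreviation itin :: "complex \<Rightarrow> nat \<Rightarrow> int" where
  "itin \<equiv> itinerary E"

lemma itin_iter: "itin ((E ^^ n) z) j = itin z (n + j)"
  by (simp add: itinerary_def add.commute[of n] funpow_add)

lemma itin_0_eqI:
  assumes "- pi \<le> Im z - 2 * pi * of_int k" "Im z - 2 * pi * of_int k < pi"
  shows "itin z 0 = k"
  unfolding itinerary_def by (rule floor_unique) (use assms in \<open>auto simp: field_simps\<close>)

lemma Im_itin_0_bounds:
  "- pi \<le> Im z - 2 * pi * of_int (itin z 0)" "Im z - 2 * pi * of_int (itin z 0) < pi"
proof -
  have "itin z 0 = \<lfloor>(Im z + pi) / (2 * pi)\<rfloor>"
    by (simp add: itinerary_def)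
  then have "of_int (itin z 0) \<le> (Im z + pi) / (2 * pi)"
    "(Im z + pi) / (2 * pi) < of_int (itin z 0) + 1"
    by linarith+
  then show "- pi \<le> Im z - 2 * pi * of_int (itin z 0)" "Im z - 2 * pi * of_int (itin z 0) < pi"
    by (simp_all add: field_simps)
qed

lemma trapped_eq_inv_branch:
  assumes "z \<in> trapped"
  shows "z = inv_branch (itin z 0) (E z)"
proof (rule inv_branch_E[symmetric])
  have "Im z - 2 * pi * of_int (itin z 0) \<noteq> - pi"
  proof
    assume "Im z - 2 * pi * of_int (itin z 0) = - pi"
    then have "Im z = - pi + 2 * pi * of_int (itin z 0)"
      by simp
    then have "cos (Im z) = - 1"
      by (simp add: cos_add)
    then have "Re (E z) < 0"
      by (simp add: Re_E)
    then show False
      using trapped_Re_ge[OF trapped_E[OF assms]] B_gt_1 by linarith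
  qed
  then show "- pi < Im z - 2 * pi * of_int (itin z 0)"
    using Im_itin_0_bounds(1)[of z] by linarith
  show "Im z - 2 * pi * of_int (itin z 0) \<le> pi"
    using Im_itin_0_bounds(2)[of z] by linarith
qed

lemma trapped_Im_near:
  assumes "z \<in> trapped"
  shows "\<bar>Im z - 2 * pi * of_int (itin z 0)\<bar> < pi / 2"
proof -
  have "0 < Re (E z)"
    using trapped_Re_ge[OF trapped_E[OF assms]] B_gt_1 by linarith
  then show ?thesis
    using Im_inv_branch_near[of "E z" "itin z 0"] by (simp flip: trapped_eq_inv_branch[OF assms])
qed

lemma itin_0_eq_if_Im_near:
  assumes "z \<in> trapped" "w \<in> trapped" "\<bar>Im z - Im w\<bar> \<le> pi"
  shows "itin z 0 = itin w 0"
proof -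
  define d where "d = itin z 0 - itin w 0"
  have "2 * pi * of_int d = 2 * pi * of_int (itin z 0) - 2 * pi * of_int (itin w 0)"
    by (simp add: d_def algebra_simps)
  then have "\<bar>2 * pi * of_int d\<bar> < 2 * pi * 1"
    using trapped_Im_near[OF assms(1)] trapped_Im_near[OF assms(2)] assms(3) by linarith
  then have "2 * pi * \<bar>of_int d\<bar> < 2 * pi * 1"
    by (simp add: abs_mult)
  then have "\<bar>real_of_int d\<bar> < 1"
    by (subst (asm) mult_less_cancel_left_pos) auto
  then show ?thesis
    by (simp add: d_def)
qed

section \<open>The order on a hair\<close>

lemma in_hair_iff: "z \<in> hair E s \<longleftrightarrow> z \<in> trapped \<and> itin z = s"
  by (simp add: hair_def julia_set_eq_trapped)

lemma hair_iter:
  assumes "z \<in> hair E s"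
  shows "(E ^^ n) z \<in> hair E (\<lambda>j. s (n + j))"
  using assms by (auto simp: in_hair_iff trapped_iter itin_iter)

lemma hair_E:
  assumes "z \<in> hair E s"
  shows "E z \<in> hair E (\<lambda>j. s (Suc j))"
  using hair_iter[OF assms, of 1] by simp

lemma hair_Re_ge: "z \<in> hair E s \<Longrightarrow> B \<le> Re z"
  by (simp add: in_hair_iff trapped_Re_ge)

lemma hair_Im_diff_less:
  assumes "z \<in> hair E s" "w \<in> hair E s"
  shows "\<bar>Im z - Im w\<bar> < pi"
proof -
  have "\<bar>Im z - 2 * pi * of_int (s 0)\<bar> < pi / 2" "\<bar>Im w - 2 * pi * of_int (s 0)\<bar> < pi / 2"
    using assms trapped_Im_near[of z] trapped_Im_near[of w] by (auto simp: in_hair_iff)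
  then show ?thesis
    by linarith
qed

lemma hair_E_expanding:
  assumes "z \<in> hair E s" "w \<in> hair E s"
  shows "B * dist z w \<le> dist (E z) (E w)"
proof -
  have "z = inv_branch (s 0) (E z)" "w = inv_branch (s 0) (E w)"
    using assms by (metis in_hair_iff trapped_eq_inv_branch)+
  moreover have "dist (inv_branch (s 0) (E z)) (inv_branch (s 0) (E w)) \<le> 1 / B * dist (E z) (E w)"
    using assms[THEN hair_E, THEN hair_Re_ge] B_gt_1
    by (intro lipschitz_onD[OF lipschitz_on_inv_branch]) auto
  ultimately have "dist z w \<le> 1 / B * dist (E z) (E w)"
    by metis
  then show ?thesis
    using B_gt_1 by (simp add: field_simps)
qed

lemma hair_E_iter_expanding:
  assumes "z \<in> hair E s" "w \<in> hair E s"
  shows "B ^ n * dist z w \<le> dist ((E ^^ n) z) ((E ^^ n) w)"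
proof (induction n)
  case (Suc n)
  have "B ^ Suc n * dist z w \<le> B * dist ((E ^^ n) z) ((E ^^ n) w)"
    using Suc B_gt_1 by simp
  also have "\<dots> \<le> dist (E ((E ^^ n) z)) (E ((E ^^ n) w))"
    by (rule hair_E_expanding[OF assms[THEN hair_iter]])
  finally show ?case
    by simp
qed simp

lemma norm_E_gap:
  assumes "Re w + 3 \<le> Re z"
  shows "8 * norm (E w) \<le> norm (E z)"
proof -
  have "2 ^ 3 \<le> exp (1::real) ^ 3"
    using exp_ge_add_one_self[of "1::real"] by (intro power_mono) auto
  also have "exp (1::real) ^ 3 = exp 3"
    using exp_of_nat_mult[of 3 "1::real"] by simp
  also have "\<dots> \<le> exp (Re z - Re w)"
    using assms by simp
  finally have "8 * norm (E w) \<le> exp (Re z - Re w) * norm (E w)"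
    by (intro mult_right_mono) auto
  also have "\<dots> = norm (E z)"
    by (simp add: norm_E flip: exp_add)
  finally show ?thesis .
qed

text \<open>A gap of \<open>3\<close> multiplies the modulus by more than the bounded difference of the imaginary
  parts of the images can account for, so it persists along the orbits.\<close>

lemma hair_gap_E:
  assumes hair: "z \<in> hair E s" "w \<in> hair E s" and gap: "Re w + 3 < Re z"
  shows "Re (E w) + 3 < Re (E z)"
proof (rule ccontr)
  assume "\<not> Re (E w) + 3 < Re (E z)"
  note images = hair[THEN hair_E]
  have "norm (E z) \<le> norm (E w) + 3 + \<bar>Im (E z) - Im (E w)\<bar>"
    using \<open>\<not> _\<close> hair_Re_ge[OF images(1)] B_gt_1 by (intro norm_le_norm_plus_Re_Im) auto
  moreover have "\<bar>Im (E z) - Im (E w)\<bar> < 4"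
    using hair_Im_diff_less[OF images] pi_less_4 by linarith
  moreover have "1 < norm (E w)"
    using hair_Re_ge[OF images(2)] B_gt_1 complex_Re_le_cmod[of "E w"] by linarith
  moreover have "8 * norm (E w) \<le> norm (E z)"
    using gap by (intro norm_E_gap) simp
  ultimately show False
    by linarith
qed

lemma hair_gap_iter:
  assumes hair: "z \<in> hair E s" "w \<in> hair E s"
    and gap: "Re ((E ^^ n) w) + 3 < Re ((E ^^ n) z)" and "n \<le> m"
  shows "Re ((E ^^ m) w) + 3 < Re ((E ^^ m) z)"
  using \<open>n \<le> m\<close>
proof (induction rule: dec_induct)
  case (step m)
  then show ?case
    using hair_gap_E[OF hair[THEN hair_iter]] by simp
qed (rule gap)

definition below :: "complex \<Rightarrow> complex \<Rightarrow> bool" where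
  "below w z \<longleftrightarrow> (\<exists>n. Re ((E ^^ n) w) + 3 < Re ((E ^^ n) z))"

lemma open_below: "open {w. below w z}" "open {w. below z w}"
  unfolding below_def Collect_ex_eq
  by (intro open_UN ballI open_Collect_less continuous_intros continuous_on_E_iter)+

lemma below_asym:
  assumes hair: "z \<in> hair E s" "w \<in> hair E s" and "below w z"
  shows "\<not> below z w"
proof
  assume "below z w"
  then obtain m n where m: "Re ((E ^^ m) z) + 3 < Re ((E ^^ m) w)"
    and n: "Re ((E ^^ n) w) + 3 < Re ((E ^^ n) z)"
    using \<open>below w z\<close> by (auto simp: below_def)
  show False
    using hair_gap_iter[OF hair(2,1) m, of "max m n"] hair_gap_iter[OF hair n, of "max m n"] by simp
qed

lemma hair_Re_diff_at_top:
  assumes hair: "z \<in> hair E s" "w \<in> hair E s" and "z \<noteq> w"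
  shows "filterlim (\<lambda>n. \<bar>Re ((E ^^ n) z) - Re ((E ^^ n) w)\<bar>) at_top sequentially"
proof (rule filterlim_at_top_mono)
  show "filterlim (\<lambda>n. B ^ n * dist z w - pi) at_top sequentially"
    using B_gt_1 \<open>z \<noteq> w\<close> by real_asymp
  show "\<forall>\<^sub>F n in sequentially. B ^ n * dist z w - pi \<le> \<bar>Re ((E ^^ n) z) - Re ((E ^^ n) w)\<bar>"
  proof (intro always_eventually allI)
    fix n
    have "B ^ n * dist z w \<le> norm ((E ^^ n) z - (E ^^ n) w)"
      using hair_E_iter_expanding[OF hair] by (simp add: dist_norm)
    also have "\<dots> \<le> \<bar>Re ((E ^^ n) z) - Re ((E ^^ n) w)\<bar> + \<bar>Im ((E ^^ n) z) - Im ((E ^^ n) w)\<bar>"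
      using cmod_le[of "(E ^^ n) z - (E ^^ n) w"] by simp
    finally show "B ^ n * dist z w - pi \<le> \<bar>Re ((E ^^ n) z) - Re ((E ^^ n) w)\<bar>"
      using hair_Im_diff_less[OF hair[THEN hair_iter], of n] by linarith
  qed
qed

lemma below_linear:
  assumes "z \<in> hair E s" "w \<in> hair E s" "z \<noteq> w"
  shows "below z w \<or> below w z"
proof -
  obtain n where "3 < \<bar>Re ((E ^^ n) z) - Re ((E ^^ n) w)\<bar>"
    using hair_Re_diff_at_top[OF assms] by (auto simp: filterlim_at_top_dense eventually_sequentially)
  then have "Re ((E ^^ n) w) + 3 < Re ((E ^^ n) z) \<or> Re ((E ^^ n) z) + 3 < Re ((E ^^ n) w)"
    by linarith
  then show ?thesis
    by (auto simp: below_def)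
qed

lemma below_imp_eventually_gap:
  assumes hair: "z \<in> hair E s" "w \<in> hair E s" and "below w z"
  shows "\<forall>\<^sub>F n in sequentially. Re ((E ^^ n) w) + K < Re ((E ^^ n) z)"
proof -
  obtain m where m: "Re ((E ^^ m) w) + 3 < Re ((E ^^ m) z)"
    using \<open>below w z\<close> by (auto simp: below_def)
  then have "z \<noteq> w"
    by auto
  then have "\<forall>\<^sub>F n in sequentially. K < \<bar>Re ((E ^^ n) z) - Re ((E ^^ n) w)\<bar>"
    using hair_Re_diff_at_top[OF hair] by (simp add: filterlim_at_top_dense)
  with eventually_ge_at_top[of m] show ?thesis
  proof eventually_elim
    case (elim n)
    then show ?case
      using hair_gap_iter[OF hair m, of n] by linarith
  qed
qed

lemma connected_hair_order_convex:
  assumes S: "connected S" "S \<subseteq> hair E s" "x \<in> S" "y \<in> S"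
    and w: "w \<in> hair E s" "below x w" "below w y"
  shows "w \<in> S"
proof (rule ccontr)
  assume "w \<notin> S"
  then have "S \<subseteq> {v. below v w} \<union> {v. below w v}"
    using below_linear[OF _ w(1)] S(2) by blast
  moreover have "{v. below v w} \<inter> {v. below w v} \<inter> S = {}"
    using below_asym[OF _ w(1)] below_asym[OF w(1)] S(2) by blast
  ultimately have "{v. below v w} \<inter> S = {} \<or> {v. below w v} \<inter> S = {}"
    by (intro connectedD S(1) open_below)
  then show False
    using S(3,4) w(2,3) by blast
qed

section \<open>Parametrisation of a hair from its minimal point\<close>

text \<open>Adding \<open>stretch z t\<close> to \<open>E z\<close> multiplies its modulus by \<open>exp t\<close> up to a factor of \<open>2\<close>, and the
  modulus of \<open>E (z + t)\<close> is \<open>exp t * norm (E z)\<close>. Hence one step of pulling back moves the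
  approximation by a bounded amount only.\<close>

definition stretch :: "complex \<Rightarrow> real \<Rightarrow> real" where
  "stretch z t = norm (E z) * (exp t - 1)"

primrec curve_approx :: "nat \<Rightarrow> complex \<Rightarrow> real \<Rightarrow> complex" where
  "curve_approx 0 z t = z + of_real t"
| "curve_approx (Suc n) z t = inv_branch (itin z 0) (curve_approx n (E z) (stretch z t))"

definition hair_curve :: "complex \<Rightarrow> real \<Rightarrow> complex" where
  "hair_curve z t = z + of_real t + (\<Sum>n. curve_approx (Suc n) z t - curve_approx n z t)"

definition curve_error :: real where
  "curve_error = (\<Sum>n. 5 * (1 / B) ^ n)"

lemma stretch_nonneg: "0 \<le> t \<Longrightarrow> 0 \<le> stretch z t"
  by (simp add: stretch_def)

lemma stretch_0 [simp]: "stretch z 0 = 0"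
  by (simp add: stretch_def)

lemma continuous_on_stretch: "continuous_on S (stretch z)"
  unfolding stretch_def[abs_def] by (intro continuous_intros)

lemma stretch_expanding:
  assumes z: "z \<in> trapped" and "0 \<le> t" "t \<le> u"
  shows "B * (u - t) \<le> stretch z u - stretch z t"
proof -
  have "u - t \<le> exp t * (exp (u - t) - 1)"
    using mult_mono[of 1 "exp t" "u - t" "exp (u - t) - 1"] assms exp_ge_add_one_self[of "u - t"]
    by simp
  also have "\<dots> = exp u - exp t"
    by (simp add: exp_diff field_simps)
  finally have "u - t \<le> exp u - exp t" .
  moreover have "B \<le> norm (E z)"
    using trapped_Re_ge[OF trapped_E[OF z]] complex_Re_le_cmod by (rule order_trans)
  ultimately have "B * (u - t) \<le> norm (E z) * (exp u - exp t)"
    using B_gt_1 \<open>t \<le> u\<close> by (intro mult_mono) auto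
  then show ?thesis
    by (simp add: stretch_def algebra_simps)
qed

lemma Re_curve_approx_ge:
  assumes "z \<in> trapped" "0 \<le> t"
  shows "B \<le> Re (curve_approx n z t)"
  using assms
proof (induction n arbitrary: z t)
  case 0
  then show ?case
    using trapped_Re_ge by fastforce
qed (simp add: Re_inv_branch_ge trapped_E stretch_nonneg)

lemma continuous_on_inv_branch: "continuous_on {z. B \<le> Re z} (inv_branch k)"
  using B_gt_1 by (intro lipschitz_on_continuous_on[OF lipschitz_on_inv_branch]) simp

lemma continuous_on_curve_approx:
  assumes "z \<in> trapped"
  shows "continuous_on {0..} (curve_approx n z)"
  using assms
proof (induction n arbitrary: z)
  case 0
  show ?case
    by (auto intro!: continuous_intros)
next
  case (Suc n)
  have "continuous_on {0..} (\<lambda>t. curve_approx n (E z) (stretch z t))"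
    using stretch_nonneg
    by (intro continuous_on_compose2[OF Suc.IH[OF trapped_E[OF Suc.prems]] continuous_on_stretch]) auto
  then have "continuous_on {0..} (\<lambda>t. inv_branch (itin z 0) (curve_approx n (E z) (stretch z t)))"
    using Re_curve_approx_ge[OF trapped_E[OF Suc.prems] stretch_nonneg]
    by (intro continuous_on_compose2[OF continuous_on_inv_branch]) auto
  then show ?case
    by simp
qed

lemma curve_approx_0: "z \<in> trapped \<Longrightarrow> curve_approx n z 0 = z"
proof (induction n arbitrary: z)
  case (Suc n)
  then show ?case
    by (simp add: trapped_E flip: trapped_eq_inv_branch)
qed simp

lemma curve_approx_step_le:
  assumes "z \<in> trapped" "0 \<le> t"
  shows "norm (curve_approx (Suc n) z t - curve_approx n z t) \<le> 5 * (1 / B) ^ n"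
  using assms
proof (induction n arbitrary: z t)
  case 0
  have "0 < Re (E z)"
    using trapped_Re_ge[OF trapped_E[OF 0(1)]] B_gt_1 by linarith
  then have "norm (Ln (E z + of_real (stretch z t)) - Ln (E z) - of_real t) \<le> 5"
    unfolding stretch_def using 0(2) by (rule norm_Ln_add_norm_le)
  also have "Ln (E z + of_real (stretch z t)) - Ln (E z) - of_real t =
      inv_branch (itin z 0) (E z + of_real (stretch z t)) - inv_branch (itin z 0) (E z) - of_real t"
    by (simp add: inv_branch_def)
  also have "\<dots> = curve_approx (Suc 0) z t - curve_approx 0 z t"
    by (simp flip: trapped_eq_inv_branch[OF 0(1)])
  finally show ?case
    by simp
next
  case (Suc n)
  define u where "u = stretch z t"
  have Ez: "E z \<in> trapped" "0 \<le> u"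
    using Suc.prems by (simp_all add: trapped_E stretch_nonneg u_def)
  have "dist (curve_approx (Suc (Suc n)) z t) (curve_approx (Suc n) z t)
      \<le> (1 / B) * dist (curve_approx (Suc n) (E z) u) (curve_approx n (E z) u)"
    unfolding curve_approx.simps(2)[of _ z] u_def[symmetric]
    using B_gt_1 Re_curve_approx_ge[OF Ez]
    by (intro lipschitz_onD[OF lipschitz_on_inv_branch]) (auto simp del: curve_approx.simps)
  also have "\<dots> \<le> (1 / B) * (5 * (1 / B) ^ n)"
    unfolding dist_norm using B_gt_1 Suc.IH[OF Ez] by (intro mult_left_mono) auto
  finally show ?case
    by (simp add: dist_norm)
qed

lemma summable_curve_error: "summable (\<lambda>n. 5 * (1 / B) ^ n)"
  using B_gt_1 by (intro summable_mult summable_geometric) auto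

lemma norm_hair_curve_diff_le:
  assumes "z \<in> trapped" "0 \<le> t"
  shows "norm (hair_curve z t - (z + of_real t)) \<le> curve_error"
  unfolding hair_curve_def curve_error_def add_diff_cancel_left'
  by (rule norm_suminf_le[OF curve_approx_step_le[OF assms] summable_curve_error])

lemma uniform_limit_curve_approx:
  assumes "z \<in> trapped"
  shows "uniform_limit {0..} (\<lambda>n. curve_approx n z) (hair_curve z) sequentially"
proof -
  define d where "d n t = curve_approx (Suc n) z t - curve_approx n z t" for n t
  have "uniform_limit {0..} (\<lambda>n t. \<Sum>i<n. d i t) (\<lambda>t. \<Sum>i. d i t) sequentially"
    using curve_approx_step_le[OF assms]
    by (intro Weierstrass_m_test[OF _ summable_curve_error]) (auto simp: d_def)
  then have "uniform_limit {0..} (\<lambda>n t. z + of_real t + (\<Sum>i<n. d i t)) (hair_curve z) sequentially"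
    unfolding hair_curve_def[abs_def] d_def[symmetric] by (intro uniform_limit_intros)
  moreover have "z + of_real t + (\<Sum>i<n. d i t) = curve_approx n z t" for n t
    unfolding d_def by (subst sum_lessThan_telescope) simp
  ultimately show ?thesis
    by simp
qed

lemma curve_approx_tendsto:
  assumes "z \<in> trapped" "0 \<le> t"
  shows "(\<lambda>n. curve_approx n z t) \<longlonglongrightarrow> hair_curve z t"
  using tendsto_uniform_limitI[OF uniform_limit_curve_approx[OF assms(1)]] assms(2) by simp

lemma continuous_on_hair_curve:
  assumes "z \<in> trapped"
  shows "continuous_on {0..} (hair_curve z)"
  by (rule uniform_limit_theorem[OF _ uniform_limit_curve_approx[OF assms]])
    (auto intro!: always_eventually continuous_on_curve_approx assms)

lemma Re_hair_curve_ge: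
  assumes "z \<in> trapped" "0 \<le> t"
  shows "B \<le> Re (hair_curve z t)"
  by (rule LIMSEQ_le_const[OF tendsto_Re[OF curve_approx_tendsto[OF assms]]])
    (use Re_curve_approx_ge[OF assms] in auto)

lemma hair_curve_0: "z \<in> trapped \<Longrightarrow> hair_curve z 0 = z"
  by (simp add: hair_curve_def curve_approx_0 del: curve_approx.simps)

lemma hair_curve_eq_inv_branch:
  assumes "z \<in> trapped" "0 \<le> t"
  shows "hair_curve z t = inv_branch (itin z 0) (hair_curve (E z) (stretch z t))"
proof (rule LIMSEQ_unique)
  show "(\<lambda>n. curve_approx (Suc n) z t) \<longlonglongrightarrow> hair_curve z t"
    by (rule LIMSEQ_Suc[OF curve_approx_tendsto[OF assms]])
  have image: "E z \<in> trapped" "0 \<le> stretch z t"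
    using assms by (simp_all add: trapped_E stretch_nonneg)
  show "(\<lambda>n. curve_approx (Suc n) z t) \<longlonglongrightarrow> inv_branch (itin z 0) (hair_curve (E z) (stretch z t))"
    unfolding curve_approx.simps(2)
    by (rule continuous_on_tendsto_compose[OF continuous_on_inv_branch curve_approx_tendsto[OF image]])
      (auto intro!: always_eventually Re_hair_curve_ge Re_curve_approx_ge image)
qed

lemma E_hair_curve:
  assumes "z \<in> trapped" "0 \<le> t"
  shows "E (hair_curve z t) = hair_curve (E z) (stretch z t)"
proof -
  have "B \<le> Re (hair_curve (E z) (stretch z t))"
    using assms by (intro Re_hair_curve_ge trapped_E stretch_nonneg)
  then have "hair_curve (E z) (stretch z t) \<noteq> 0"
    using B_gt_1 by auto
  then show ?thesis
    by (simp add: hair_curve_eq_inv_branch[OF assms] E_inv_branch)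
qed

lemma E_iter_hair_curve:
  assumes "z \<in> trapped" "0 \<le> t"
  shows "\<exists>u\<ge>0. (E ^^ n) (hair_curve z t) = hair_curve ((E ^^ n) z) u"
proof (induction n)
  case 0
  then show ?case
    using assms(2) by auto
next
  case (Suc n)
  then show ?case
    using E_hair_curve[OF trapped_iter[OF assms(1)]] stretch_nonneg by fastforce
qed

lemma itin_0_hair_curve:
  assumes "z \<in> trapped" "0 \<le> t"
  shows "itin (hair_curve z t) 0 = itin z 0"
proof -
  have "B \<le> Re (hair_curve (E z) (stretch z t))"
    using assms by (intro Re_hair_curve_ge trapped_E stretch_nonneg)
  then have "\<bar>Im (hair_curve z t) - 2 * pi * of_int (itin z 0)\<bar> < pi / 2"
    unfolding hair_curve_eq_inv_branch[OF assms] using B_gt_1 by (intro Im_inv_branch_near) simp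
  then show ?thesis
    using pi_gt_zero by (intro itin_0_eqI) linarith+
qed

lemma hair_curve_in_hair:
  assumes z: "z \<in> hair E s" and "0 \<le> t"
  shows "hair_curve z t \<in> hair E s"
proof -
  have trapped: "z \<in> trapped" and s: "itin z = s"
    using z by (simp_all add: in_hair_iff)
  have "B \<le> Re ((E ^^ n) (hair_curve z t)) \<and> itin (hair_curve z t) n = s n" for n
  proof -
    obtain u where u: "0 \<le> u" "(E ^^ n) (hair_curve z t) = hair_curve ((E ^^ n) z) u"
      using E_iter_hair_curve[OF trapped \<open>0 \<le> t\<close>] by blast
    have "itin (hair_curve z t) n = itin ((E ^^ n) (hair_curve z t)) 0"
      by (simp add: itin_iter)
    also have "\<dots> = itin ((E ^^ n) z) 0"
      unfolding u(2) using trapped u(1) by (intro itin_0_hair_curve trapped_iter)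
    also have "\<dots> = s n"
      by (simp add: itin_iter s)
    finally show ?thesis
      using Re_hair_curve_ge[OF trapped_iter[OF trapped] u(1)] u(2) by simp
  qed
  then show ?thesis
    by (simp add: in_hair_iff trapped_def fun_eq_iff)
qed

lemma hair_curve_eq_imp_near:
  assumes "z \<in> trapped" "0 \<le> t" "t \<le> u" "hair_curve z t = hair_curve z u"
  shows "B ^ n * (u - t) \<le> 2 * curve_error"
  using assms
proof (induction n arbitrary: z t u)
  case 0
  have "u - t \<le> norm (of_real u - of_real t :: complex)"
    by (simp flip: of_real_diff)
  also have "of_real u - of_real t =
      (hair_curve z t - (z + of_real t)) - (hair_curve z u - (z + of_real u))"
    using 0 by simp
  also have "norm \<dots> \<le> curve_error + curve_error"
    using 0 by (intro order_trans[OF norm_triangle_ineq4] add_mono norm_hair_curve_diff_le) auto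
  finally show ?case
    by simp
next
  case (Suc n)
  have expand: "B * (u - t) \<le> stretch z u - stretch z t"
    using Suc.prems by (intro stretch_expanding)
  have "0 \<le> B * (u - t)"
    using B_gt_1 Suc.prems by simp
  then have "stretch z t \<le> stretch z u"
    using expand by linarith
  moreover have "hair_curve (E z) (stretch z t) = hair_curve (E z) (stretch z u)"
    using Suc.prems E_hair_curve[of z t] E_hair_curve[of z u] by simp
  ultimately have "B ^ n * (stretch z u - stretch z t) \<le> 2 * curve_error"
    using Suc.prems by (intro Suc.IH[OF trapped_E] stretch_nonneg)
  moreover have "B ^ n * (B * (u - t)) \<le> B ^ n * (stretch z u - stretch z t)"
    using expand B_gt_1 by (intro mult_left_mono) auto
  ultimately show ?case
    by (simp add: mult.assoc mult.left_commute)
qed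

lemma inj_on_hair_curve:
  assumes "z \<in> trapped"
  shows "inj_on (hair_curve z) {0..}"
proof (rule linorder_inj_onI')
  fix t u :: real assume tu: "t \<in> {0..}" "t < u"
  have "filterlim (\<lambda>n. B ^ n * (u - t)) at_top sequentially"
    using B_gt_1 \<open>t < u\<close> by real_asymp
  then obtain n where "2 * curve_error < B ^ n * (u - t)"
    by (auto simp: filterlim_at_top_dense eventually_sequentially)
  then show "hair_curve z t \<noteq> hair_curve z u"
    using hair_curve_eq_imp_near[OF assms, of t u n] tu by auto
qed

lemma filterlim_Re_hair_curve:
  assumes "z \<in> trapped"
  shows "filterlim (\<lambda>t. Re (hair_curve z t)) at_top at_top"
proof (rule filterlim_at_top_mono)
  show "filterlim (\<lambda>t. Re z + t - curve_error) at_top at_top"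
    by real_asymp
  show "\<forall>\<^sub>F t in at_top. Re z + t - curve_error \<le> Re (hair_curve z t)"
    using eventually_ge_at_top[of 0]
  proof eventually_elim
    case (elim t)
    then show ?case
      using norm_hair_curve_diff_le[OF assms elim]
        abs_Re_le_cmod[of "hair_curve z t - (z + of_real t)"]
      by simp
  qed
qed

lemma hair_curve_image_eq:
  assumes z: "z \<in> hair E s" and min: "\<And>w. w \<in> hair E s \<Longrightarrow> \<not> below w z"
  shows "hair_curve z ` {0..} = hair E s"
proof
  have trapped: "z \<in> trapped"
    using z by (simp add: in_hair_iff)
  have z_in: "z \<in> hair_curve z ` {0..}"
    using hair_curve_0[OF trapped] by force
  show sub: "hair_curve z ` {0..} \<subseteq> hair E s"
    using hair_curve_in_hair[OF z] by auto
  show "hair E s \<subseteq> hair_curve z ` {0..}"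
  proof
    fix w assume w: "w \<in> hair E s"
    show "w \<in> hair_curve z ` {0..}"
    proof (cases "w = z")
      case False
      then have "below z w"
        using below_linear[OF z w] min[OF w] by auto
      moreover have "\<forall>\<^sub>F t in at_top. 0 \<le> t \<and> Re w + 3 < Re (hair_curve z t)"
        using filterlim_Re_hair_curve[OF trapped] eventually_ge_at_top[of 0]
        by (simp add: filterlim_at_top_dense eventually_conj)
      then obtain t where "0 \<le> t" "Re w + 3 < Re (hair_curve z t)"
        by (auto simp: eventually_at_top_linorder)
      then have "below w (hair_curve z t)"
        unfolding below_def by (intro exI[of _ 0]) simp
      moreover have "connected (hair_curve z ` {0..})"
        by (intro connected_continuous_image continuous_on_hair_curve trapped) simp
      ultimately show ?thesis
        using \<open>0 \<le> t\<close> by (intro connected_hair_order_convex[OF _ sub z_in _ w]) auto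
    qed (use z_in in simp)
  qed
qed

lemma minimal_in_endpoints:
  assumes z: "z \<in> hair E s" and "\<And>w. w \<in> hair E s \<Longrightarrow> \<not> below w z"
  shows "z \<in> endpoints E"
  unfolding endpoints_def
proof (intro CollectI exI conjI)
  have trapped: "z \<in> trapped"
    using z by (simp add: in_hair_iff)
  show "z = hair_curve z 0"
    by (rule hair_curve_0[OF trapped, symmetric])
  show "continuous_on {0..} (hair_curve z)" "inj_on (hair_curve z) {0..}"
    using trapped by (rule continuous_on_hair_curve inj_on_hair_curve)+
  show "hair_curve z ` {0..} = hair E s"
    using assms by (rule hair_curve_image_eq)
  show "filterlim (\<lambda>t. norm (hair_curve z t)) at_top at_top"
    using filterlim_Re_hair_curve[OF trapped]
    by (rule filterlim_at_top_mono) (simp add: complex_Re_le_cmod)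
qed

section \<open>Tame orbits\<close>

definition tame :: "complex set" where
  "tame = {z \<in> trapped. \<forall>n. \<bar>Im ((E ^^ n) z)\<bar> \<le> Re ((E ^^ n) z) \<and>
     \<bar>Im ((E ^^ Suc n) z)\<bar> \<le> exp (Re ((E ^^ n) z) / 2)}"

lemma tame_trapped: "z \<in> tame \<Longrightarrow> z \<in> trapped"
  by (simp add: tame_def)

lemma tame_Im_le:
  assumes "z \<in> tame"
  shows "\<bar>Im z\<bar> \<le> Re z" "\<bar>Im (E z)\<bar> \<le> exp (Re z / 2)"
  using assms by (auto simp: tame_def dest: spec[of _ 0])

lemma tame_E:
  assumes "z \<in> tame"
  shows "E z \<in> tame"
proof -
  have "\<bar>Im ((E ^^ n) z)\<bar> \<le> Re ((E ^^ n) z) \<and> \<bar>Im ((E ^^ Suc n) z)\<bar> \<le> exp (Re ((E ^^ n) z) / 2)" for n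
    using assms unfolding tame_def by blast
  from this[of "Suc _"] show ?thesis
    unfolding tame_def funpow_Suc_right comp_apply using trapped_E[OF tame_trapped[OF assms]] by blast
qed

lemma tame_norm_le: "z \<in> tame \<Longrightarrow> norm z \<le> 2 * Re z"
  using tame_Im_le(1)[of z] cmod_le[of z] by linarith

lemma hair_gap_imp_Im_E_le:
  assumes hair: "z \<in> hair E s" "w \<in> hair E s" and gap: "Re w + 3 \<le> Re z" and "10 \<le> Re (E z)"
  shows "\<bar>Im (E z)\<bar> \<le> Re (E z)" "norm (E w) \<le> Re (E z) / 4"
proof -
  have modulus: "8 * norm (E w) \<le> norm (E z)" "norm (E z) \<le> Re (E z) + \<bar>Im (E z)\<bar>"
    using norm_E_gap[OF gap] cmod_le[of "E z"] \<open>10 \<le> Re (E z)\<close> by auto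
  then show "\<bar>Im (E z)\<bar> \<le> Re (E z)"
    using hair_Im_diff_less[OF hair[THEN hair_E]] abs_Im_le_cmod[of "E w"] pi_less_4 \<open>10 \<le> Re (E z)\<close>
    by linarith
  then show "norm (E w) \<le> Re (E z) / 4"
    using modulus by linarith
qed

lemma hair_Im_E_le_exp_half:
  assumes hair: "z \<in> hair E s" "w \<in> hair E s" and "norm w \<le> Re z / 4" "10 \<le> Re z"
  shows "\<bar>Im (E z)\<bar> \<le> exp (Re z / 2)"
proof -
  define y where "y = exp (Re z / 4)"
  have "Re w - B \<le> Re z / 4"
    using assms(3) complex_Re_le_cmod[of w] B_gt_1 by linarith
  then have "norm (E w) \<le> y"
    by (simp add: norm_E y_def)
  then have "\<bar>Im (E z)\<bar> \<le> y + 4"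
    using hair_Im_diff_less[OF hair[THEN hair_E]] abs_Im_le_cmod[of "E w"] pi_less_4 by linarith
  also have "\<dots> \<le> y * y"
  proof -
    have "7 / 2 \<le> y"
      using \<open>10 \<le> Re z\<close> exp_ge_add_one_self[of "Re z / 4"] unfolding y_def by linarith
    moreover from this have "7 / 2 * y \<le> y * y"
      by (intro mult_right_mono) auto
    ultimately show ?thesis
      by linarith
  qed
  also have "\<dots> = exp (Re z / 2)"
    by (simp add: y_def flip: exp_add)
  finally show ?thesis .
qed

lemma below_imp_eventually_tame:
  assumes hair: "z \<in> hair E s" "w \<in> hair E s" and "below w z"
  shows "\<forall>\<^sub>F n in sequentially. (E ^^ n) z \<in> tame \<and> A \<le> Re ((E ^^ n) z)"
proof -
  define K where "K = max 10 A"
  obtain N where gap: "\<And>n. N \<le> n \<Longrightarrow> Re ((E ^^ n) w) + K < Re ((E ^^ n) z)"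
    using below_imp_eventually_gap[OF assms, of K] by (auto simp: eventually_sequentially)
  have large: "K \<le> Re ((E ^^ n) z)" if "N \<le> n" for n
    using gap[OF that] hair_Re_ge[OF hair_iter[OF hair(2)], of n] B_gt_1 by linarith
  have Im_le: "\<bar>Im ((E ^^ Suc n) z)\<bar> \<le> Re ((E ^^ Suc n) z) \<and>
      \<bar>Im ((E ^^ Suc (Suc n)) z)\<bar> \<le> exp (Re ((E ^^ Suc n) z) / 2)" if "N \<le> n" for n
  proof -
    define u v where "u = (E ^^ n) z" and "v = (E ^^ n) w"
    note hair_n = hair[THEN hair_iter[of _ s n], folded u_def v_def]
    have "Re v + 3 \<le> Re u" "10 \<le> Re (E u)"
      using gap[OF that] large[of "Suc n"] that by (auto simp: u_def v_def K_def)
    note image = hair_gap_imp_Im_E_le[OF hair_n this]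
    have "\<bar>Im (E (E u))\<bar> \<le> exp (Re (E u) / 2)"
      using hair_Im_E_le_exp_half[OF hair_n[THEN hair_E] image(2)] \<open>10 \<le> Re (E u)\<close> .
    with image(1) show ?thesis
      by (simp add: u_def)
  qed
  show ?thesis
    using eventually_ge_at_top[of "Suc N"]
  proof eventually_elim
    case (elim n)
    then have "\<bar>Im ((E ^^ (j + n)) z)\<bar> \<le> Re ((E ^^ (j + n)) z) \<and>
        \<bar>Im ((E ^^ Suc (j + n)) z)\<bar> \<le> exp (Re ((E ^^ (j + n)) z) / 2)" for j
      using Im_le[of "j + n - 1"] by simp
    then have "(E ^^ n) z \<in> tame"
      using hair(1) by (simp add: tame_def in_hair_iff trapped_iter funpow_add)
    then show ?case
      using large[of n] elim by (simp add: K_def)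
  qed
qed

section \<open>Covering tame points\<close>

definition image_radius :: "real \<Rightarrow> real" where
  "image_radius a = exp (a - B)"

definition image_height :: "real \<Rightarrow> real" where
  "image_height a = exp ((a + 1) / 2)"

lemma image_radius_pos: "0 < image_radius a"
  by (simp add: image_radius_def)

lemma E_tame_unit_box:
  assumes z: "z \<in> tame" "z \<in> unit_box a b"
  shows "image_radius a / 2 \<le> Re (E z)" "norm (E z) \<le> 3 * image_radius a"
    "\<bar>Im (E z)\<bar> \<le> image_height a"
proof -
  have Re_z: "a \<le> Re z" "Re z \<le> a + 1"
    using z(2) by (auto simp: in_unit_box_iff)
  then have "image_radius a \<le> norm (E z)"
    by (simp add: norm_E image_radius_def)
  then show "image_radius a / 2 \<le> Re (E z)"
    using tame_norm_le[OF tame_E[OF z(1)]] by linarith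
  have "norm (E z) \<le> exp (1 + (a - B))"
    using Re_z by (simp add: norm_E)
  also have "\<dots> \<le> 3 * image_radius a"
    unfolding exp_add image_radius_def using exp_le by (intro mult_right_mono) auto
  finally show "norm (E z) \<le> 3 * image_radius a" .
  have "exp (Re z / 2) \<le> image_height a"
    using Re_z by (simp add: image_height_def)
  then show "\<bar>Im (E z)\<bar> \<le> image_height a"
    using tame_Im_le(2)[OF z(1)] by linarith
qed

lemma tame_unit_box_eq_inv_branch_image:
  fixes a b :: real
  defines "S \<equiv> tame \<inter> unit_box a b"
  obtains k where "S = inv_branch k ` E ` S"
    and "(2 / image_radius a)-lipschitz_on (E ` S) (inv_branch k)"
proof -
  obtain k where k: "\<And>z. z \<in> S \<Longrightarrow> itin z 0 = k"
  proof (cases "S = {}")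
    case False
    then obtain u where u: "u \<in> tame" "u \<in> unit_box a b"
      by (auto simp: S_def)
    have "itin z 0 = itin u 0" if "z \<in> S" for z
    proof (rule itin_0_eq_if_Im_near)
      show "\<bar>Im z - Im u\<bar> \<le> pi"
        using that u(2) pi_gt3 by (auto simp: S_def in_unit_box_iff)
    qed (use that u(1) in \<open>auto simp: S_def tame_trapped\<close>)
    then show thesis
      by (rule that)
  qed (use that in simp)
  have "inv_branch k (E z) = z" if "z \<in> S" for z
    using trapped_eq_inv_branch[of z] k[OF that] that by (simp add: S_def tame_trapped)
  then have "S = inv_branch k ` E ` S"
    by (simp add: image_image)
  moreover have "E ` S \<subseteq> {w. image_radius a / 2 \<le> Re w}"
    using E_tame_unit_box(1) by (auto simp: S_def)
  then have "(2 / image_radius a)-lipschitz_on (E ` S) (inv_branch k)"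
    using lipschitz_on_subset[OF lipschitz_on_inv_branch[of "image_radius a / 2" k]]
      image_radius_pos[of a] by simp
  ultimately show thesis
    by (rule that)
qed

text \<open>With \<open>R\<close> and \<open>H\<close> the radius and height of the image, the image is covered by at most
  \<open>3 * R / H + 1\<close> rectangles of diameter at most \<open>3 * H\<close>, each shrunk by a factor of \<open>2 / R\<close> when
  pulled back.\<close>

definition strip_bound :: "(real \<Rightarrow> real) \<Rightarrow> real \<Rightarrow> real" where
  "strip_bound h a =
     (3 * image_radius a / image_height a + 1) * h (3 * (2 / image_radius a) * image_height a)"

lemma gauge_content_tame_unit_box_le_strip_bound:
  assumes h: "starshaped_gauge 1 h" and small: "3 * (2 / image_radius a) * image_height a < 1"
  shows "gauge_content h 1 (tame \<inter> unit_box a b) \<le> ennreal (strip_bound h a)"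
proof -
  define S where "S = tame \<inter> unit_box a b"
  obtain k where k: "S = inv_branch k ` E ` S"
    "(2 / image_radius a)-lipschitz_on (E ` S) (inv_branch k)"
    unfolding S_def by (rule tame_unit_box_eq_inv_branch_image)
  have "gauge_content h 1 (inv_branch k ` E ` S) \<le> ennreal (strip_bound h a)"
    unfolding strip_bound_def
  proof (rule gauge_content_lipschitz_image_strip[OF h k(2)])
    fix w assume "w \<in> E ` S"
    then obtain z where z: "z \<in> tame" "z \<in> unit_box a b" and w: "w = E z"
      by (auto simp: S_def)
    show "0 \<le> Re w \<and> Re w \<le> 3 * image_radius a \<and> \<bar>Im w\<bar> \<le> image_height a"
      using E_tame_unit_box[OF z] complex_Re_le_cmod[of w] image_radius_pos[of a]
      unfolding w by linarith
  qed (use small in \<open>auto simp: image_radius_def image_height_def\<close>)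
  then show ?thesis
    using k(1) by (simp add: S_def)
qed

lemma gauge_content_E_tame_unit_box_le:
  assumes h: "starshaped_gauge 1 h" and "0 \<le> s" "0 < d" "0 \<le> c"
    and box: "\<And>a b. A \<le> a \<Longrightarrow> gauge_content h d (tame \<inter> unit_box a b) \<le> ennreal (c * a powr (- s))"
    and radius: "4 \<le> image_radius a" "A \<le> image_radius a / 4"
  shows "gauge_content h d (E ` (tame \<inter> unit_box a b))
    \<le> ennreal (16 * (3 * image_radius a)\<^sup>2 * (c * (image_radius a / 4) powr (- s)))"
proof (rule gauge_content_le_unit_boxes)
  let ?S = "tame \<inter> unit_box a b"
  show "E ` ?S \<subseteq> cball 0 (3 * image_radius a)"
    using E_tame_unit_box(2) by auto
  fix a' b' assume "E ` ?S \<inter> unit_box a' b' \<noteq> {}"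
  then obtain z where "z \<in> ?S" "E z \<in> unit_box a' b'"
    by blast
  then have "image_radius a / 2 \<le> a' + 1"
    using E_tame_unit_box(1)[of z a b] by (simp add: in_unit_box_iff)
  then have a': "image_radius a / 4 \<le> a'"
    using radius by linarith
  have "gauge_content h d (E ` ?S \<inter> unit_box a' b') \<le> gauge_content h d (tame \<inter> unit_box a' b')"
    by (rule gauge_content_mono) (auto simp: tame_E)
  also have "\<dots> \<le> ennreal (c * a' powr (- s))"
    using a' radius by (intro box) simp
  also have "\<dots> \<le> ennreal (c * (image_radius a / 4) powr (- s))"
    using a' radius \<open>0 \<le> s\<close> \<open>0 \<le> c\<close> by (intro ennreal_leI mult_left_mono powr_mono2') auto
  finally show "gauge_content h d (E ` ?S \<inter> unit_box a' b')
    \<le> ennreal (c * (image_radius a / 4) powr (- s))" .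
qed (use assms starshaped_gauge_0[OF h] in auto)

lemma gauge_content_tame_unit_box_halve:
  assumes h: "starshaped_gauge 1 h" and "0 \<le> s" and d: "0 < d" "d \<le> 1" and "0 \<le> c"
    and box: "\<And>a b. A \<le> a \<Longrightarrow> gauge_content h d (tame \<inter> unit_box a b) \<le> ennreal (c * a powr (- s))"
    and radius: "4 \<le> image_radius a" "A \<le> image_radius a / 4"
  shows "gauge_content h (d / 2) (tame \<inter> unit_box a b)
    \<le> ennreal (c * (288 * image_radius a * (image_radius a / 4) powr (- s)))"
proof -
  define R where "R = image_radius a"
  define S where "S = tame \<inter> unit_box a b"
  define M where "M = 16 * (3 * R)\<^sup>2 * (c * (R / 4) powr (- s))"
  have "4 \<le> R" "0 \<le> M"
    using radius(1) \<open>0 \<le> c\<close> by (simp_all add: R_def M_def)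
  obtain k where k: "S = inv_branch k ` E ` S" "(2 / R)-lipschitz_on (E ` S) (inv_branch k)"
    unfolding S_def R_def by (rule tame_unit_box_eq_inv_branch_image)
  have "gauge_content h (d / 2) S \<le> gauge_content h (2 / R * d) (inv_branch k ` E ` S)"
    using k(1) \<open>4 \<le> R\<close> d by (intro gauge_content_mono) (auto simp: field_simps)
  also have "\<dots> \<le> ennreal (2 / R) * gauge_content h d (E ` S)"
    using \<open>4 \<le> R\<close> d by (intro gauge_content_lipschitz_image[OF k(2) h]) auto
  also have "\<dots> \<le> ennreal (2 / R) * ennreal M"
    unfolding M_def S_def R_def
    using gauge_content_E_tame_unit_box_le[OF h \<open>0 \<le> s\<close> d(1) \<open>0 \<le> c\<close> box radius]
    by (rule mult_left_mono) auto
  also have "\<dots> = ennreal (2 / R * M)"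
    using \<open>4 \<le> R\<close> \<open>0 \<le> M\<close> by (intro ennreal_mult[symmetric]) auto
  also have "2 / R * M = c * (288 * R * (R / 4) powr (- s))"
    using \<open>4 \<le> R\<close> by (simp add: M_def power2_eq_square)
  finally show ?thesis
    by (simp add: S_def R_def)
qed

lemma strip_bound_log_gauge_bigo: "strip_bound (log_gauge s) \<in> O(\<lambda>a. a powr (- s))"
  unfolding strip_bound_def[abs_def] image_radius_def image_height_def log_gauge_def by real_asymp

lemma eventually_image_radius_bounds:
  assumes "1 < s"
  shows "\<forall>\<^sub>F a in at_top. 3 * (2 / image_radius a) * image_height a < 1 \<and>
    4 \<le> image_radius a \<and> a \<le> image_radius a / 4 \<and>
    288 * image_radius a * (image_radius a / 4) powr (- s) \<le> 1 / 2 * a powr (- s)"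
  unfolding image_radius_def image_height_def using assms by (intro eventually_conj; real_asymp)

lemma gauge_content_log_gauge_tame_unit_box_le:
  assumes "1 < s"
  shows "\<exists>c A. \<forall>a\<ge>A. \<forall>n b. gauge_content (log_gauge s) ((1/2) ^ n) (tame \<inter> unit_box a b)
    \<le> ennreal (c * (1/2) ^ n * a powr (- s))"
proof -
  have h: "starshaped_gauge 1 (log_gauge s)"
    using assms by (intro starshaped_log_gauge) simp
  obtain c where "0 < c"
    and "\<forall>\<^sub>F a in at_top. norm (strip_bound (log_gauge s) a) \<le> c * norm (a powr (- s))"
    using strip_bound_log_gauge_bigo[of s] by (rule landau_o.bigE)
  then have "\<forall>\<^sub>F a in at_top. strip_bound (log_gauge s) a \<le> c * a powr (- s)"
    by (auto elim: eventually_mono)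
  from eventually_conj[OF this eventually_image_radius_bounds[OF assms]]
  obtain A where strip: "\<And>a. A \<le> a \<Longrightarrow> strip_bound (log_gauge s) a \<le> c * a powr (- s)"
    and radius: "\<And>a. A \<le> a \<Longrightarrow> 3 * (2 / image_radius a) * image_height a < 1 \<and>
      4 \<le> image_radius a \<and> a \<le> image_radius a / 4 \<and>
      288 * image_radius a * (image_radius a / 4) powr (- s) \<le> 1 / 2 * a powr (- s)"
    unfolding eventually_at_top_linorder by blast
  have "gauge_content (log_gauge s) ((1/2) ^ n) (tame \<inter> unit_box a b)
      \<le> ennreal (c * (1/2) ^ n * a powr (- s))" if "A \<le> a" for n a b
    using that
  proof (induction n arbitrary: a b)
    case 0
    then show ?case
      using gauge_content_tame_unit_box_le_strip_bound[OF h, of a b] radius[OF 0] strip[OF 0]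
      by (auto intro: order_trans ennreal_leI)
  next
    case (Suc n)
    have "gauge_content (log_gauge s) ((1/2) ^ n / 2) (tame \<inter> unit_box a b)
        \<le> ennreal (c * (1/2) ^ n * (288 * image_radius a * (image_radius a / 4) powr (- s)))"
      using radius[OF Suc.prems] Suc.prems assms \<open>0 < c\<close>
      by (intro gauge_content_tame_unit_box_halve[OF h] Suc.IH) (auto simp: power_le_one)
    also have "\<dots> \<le> ennreal (c * (1/2) ^ n * (1 / 2 * a powr (- s)))"
      using radius[OF Suc.prems] \<open>0 < c\<close> by (intro ennreal_leI mult_left_mono) auto
    finally show ?case
      by simp
  qed
  then show ?thesis
    by blast
qed

lemma hausdorff_log_gauge_tame_halfplane_eq_0:
  assumes "1 < s"
  shows "\<exists>A. hausdorff_gauge (log_gauge s) {z \<in> tame. A \<le> Re z} = 0"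
proof -
  obtain c A where content: "\<And>a n b. A \<le> a \<Longrightarrow>
      gauge_content (log_gauge s) ((1/2) ^ n) (tame \<inter> unit_box a b)
        \<le> ennreal (c * (1/2) ^ n * a powr (- s))"
    using gauge_content_log_gauge_tame_unit_box_le[OF assms] by blast
  have box: "hausdorff_gauge (log_gauge s) (tame \<inter> unit_box a b) = 0" if "A \<le> a" for a b
  proof (rule hausdorff_gauge_eq_0_sequentially[OF content[OF that]])
    show "(\<lambda>n. (1/2) ^ n) \<longlonglongrightarrow> (0::real)" "(\<lambda>n. c * (1/2) ^ n * a powr (- s)) \<longlonglongrightarrow> 0"
      by real_asymp+
  qed
  have "hausdorff_gauge (log_gauge s) {z \<in> tame. A + 1 \<le> Re z} = 0"
  proof (rule hausdorff_gauge_eq_0_unit_boxes)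
    fix m n :: int
    have "{z \<in> tame. A + 1 \<le> Re z} \<inter> unit_box m n \<subseteq> tame \<inter> unit_box (max A m) n"
      by (auto simp: in_unit_box_iff)
    then show "hausdorff_gauge (log_gauge s) ({z \<in> tame. A + 1 \<le> Re z} \<inter> unit_box m n) = 0"
      by (rule hausdorff_gauge_eq_0_subset[OF box, rotated]) simp
  qed (simp add: log_gauge_def)
  then show ?thesis ..
qed

lemma hausdorff_gauge_eq_0_E_iter_vimage:
  assumes h: "starshaped_gauge r h" "0 < r" and S: "hausdorff_gauge h S = 0"
  shows "hausdorff_gauge h (trapped \<inter> (E ^^ n) -` S) = 0"
proof (induction n)
  case 0
  show ?case
    by (rule hausdorff_gauge_eq_0_subset[OF S]) auto
next
  case (Suc n)
  define Z where "Z = trapped \<inter> (E ^^ n) -` S"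
  have "trapped \<inter> (E ^^ Suc n) -` S \<subseteq> (\<Union>k. inv_branch k ` Z)"
  proof
    fix z assume "z \<in> trapped \<inter> (E ^^ Suc n) -` S"
    then have "z = inv_branch (itin z 0) (E z)" "E z \<in> Z"
      by (auto simp: Z_def trapped_E funpow_swap1 intro: trapped_eq_inv_branch)
    then show "z \<in> (\<Union>k. inv_branch k ` Z)"
      by blast
  qed
  moreover have "1-lipschitz_on Z (inv_branch k)" for k
    using B_gt_1
    by (intro lipschitz_on_mono[OF lipschitz_on_inv_branch[of B]]) (auto simp: Z_def trapped_Re_ge)
  then have "hausdorff_gauge h (inv_branch k ` Z) = 0" for k
    using Suc.IH by (intro hausdorff_gauge_eq_0_lipschitz_image[OF _ h]) (auto simp: Z_def)
  then have "hausdorff_gauge h (\<Union>k. inv_branch k ` Z) = 0"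
    by (intro hausdorff_gauge_eq_0_countable_UN starshaped_gauge_0[OF h(1)]) auto
  ultimately show ?case
    by (rule hausdorff_gauge_eq_0_subset[rotated])
qed

lemma julia_set_minus_endpoints_subset:
  "julia_set E - endpoints E \<subseteq> (\<Union>n. trapped \<inter> (E ^^ n) -` {z \<in> tame. A \<le> Re z})"
proof
  fix z assume z: "z \<in> julia_set E - endpoints E"
  then have hair: "z \<in> hair E (itin z)"
    by (simp add: hair_def)
  then obtain w where "w \<in> hair E (itin z)" "below w z"
    using minimal_in_endpoints z by blast
  then obtain n where "(E ^^ n) z \<in> tame" "A \<le> Re ((E ^^ n) z)"
    using below_imp_eventually_tame[OF hair, of w A] by (auto simp: eventually_sequentially)
  then show "z \<in> (\<Union>n. trapped \<inter> (E ^^ n) -` {z \<in> tame. A \<le> Re z})"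
    using hair by (auto simp: in_hair_iff)
qed

end

theorem theorem1p1:
  fixes lam s :: real
  assumes "0 < lam" and "lam < 1 / exp 1" and "s > 1"
  shows "hausdorff_gauge (\<lambda>t. t / (ln (1 / t)) powr s)
           (julia_set (expmap lam) - endpoints (expmap lam)) = 0"
proof -
  interpret exp_family lam
    by unfold_locales fact+
  have h: "starshaped_gauge 1 (log_gauge s)"
    using \<open>s > 1\<close> by (intro starshaped_log_gauge) simp
  obtain A where "hausdorff_gauge (log_gauge s) {z \<in> tame. A \<le> Re z} = 0"
    using hausdorff_log_gauge_tame_halfplane_eq_0[OF \<open>s > 1\<close>] by blast
  then have "hausdorff_gauge (log_gauge s) (trapped \<inter> (E ^^ n) -` {z \<in> tame. A \<le> Re z}) = 0" for n
    by (rule hausdorff_gauge_eq_0_E_iter_vimage[OF h zero_less_one])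
  then have "hausdorff_gauge (log_gauge s) (\<Union>n. trapped \<inter> (E ^^ n) -` {z \<in> tame. A \<le> Re z}) = 0"
    by (intro hausdorff_gauge_eq_0_countable_UN starshaped_gauge_0[OF h]) auto
  then show ?thesis
    unfolding log_gauge_def
    by (rule hausdorff_gauge_eq_0_subset) (rule julia_set_minus_endpoints_subset)
qed

end
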